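(* Let $X$ be a cocompact proper geodesic metric space whose Morse boundary contains at least three points. Then every cobounded quasi-action on $X$ has a topological completion.
   Context: $X$ is cocompact if its isometry group acts cocompactly, i.e. there is a compact $K\subseteq X$ whose translates under isometries cover $X$. A geodesic ray $\gamma$ is Morse if there is a function $\phi:[1,\infty)\times[0,\infty)\to[0,\infty)$ such that every $(K,A)$-quasi-geodesic with endpoints on $\gamma$ lies in the $\phi(K,A)$-neighbourhood of $\gamma$. The Morse boundary of $X$ is the set of Morse geodesic rays modulo finite Hausdorff distance. A $(K,A)$-quasi-action of a group $G$ on $X$ assigns to each $g$ a $(K,A)$-quasi-isometry $x\mapsto g\cdot x$ with $d(h\cdot(g\cdot x),hg\cdot x)\le A$, $d(e\cdot x,x)\le A$; cobounded means for some $r$ any $x,y$ admit $g$ with $d(g\cdot x,y)\le r$. $T\subseteq G$ is bounded if $\{t\cdot x_0:t\in T\}$ is bounded. A topological completion is a homomorphism $\rho:G\to\hat G$ to a Hausdorff locally compact group with dense image such that $T\subseteq G$ is bounded iff $\overline{\rho(T)}$ is compact. *)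

theory Defs
  imports "HOL-Analysis.Analysis" "HOL-Algebra.Group"
begin

definition proper_space :: "'a::metric_space itself \<Rightarrow> bool" where
  "proper_space _ \<longleftrightarrow> (\<forall>(x::'a) r. compact (cball x r))"

definition geodesic_space :: "'a::metric_space itself \<Rightarrow> bool" where
  "geodesic_space _ \<longleftrightarrow>
     (\<forall>x y::'a. \<exists>c::real \<Rightarrow> 'a. c 0 = x \<and> c (dist x y) = y \<and>
        (\<forall>s\<in>{0..dist x y}. \<forall>t\<in>{0..dist x y}. dist (c s) (c t) = \<bar>s - t\<bar>))"

definition isometry :: "('a::metric_space \<Rightarrow> 'a) \<Rightarrow> bool" where
  "isometry f \<longleftrightarrow> bij f \<and> (\<forall>x y. dist (f x) (f y) = dist x y)"

definition cocompact :: "'a::metric_space itself \<Rightarrow> bool" where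
  "cocompact _ \<longleftrightarrow> (\<exists>K::'a set. compact K \<and> (\<Union>f\<in>{f. isometry f}. f ` K) = UNIV)"

text \<open>Geodesic ray (parametrised on [0,\<infinity>); values at negative times are irrelevant).\<close>
definition geodesic_ray :: "(real \<Rightarrow> 'a::metric_space) \<Rightarrow> bool" where
  "geodesic_ray \<gamma> \<longleftrightarrow> (\<forall>s\<ge>0. \<forall>t\<ge>0. dist (\<gamma> s) (\<gamma> t) = \<bar>s - t\<bar>)"

definition quasi_geodesic ::
  "real \<Rightarrow> real \<Rightarrow> real \<Rightarrow> real \<Rightarrow> (real \<Rightarrow> 'a::metric_space) \<Rightarrow> bool" where
  "quasi_geodesic K A a b q \<longleftrightarrow> a \<le> b \<and>
     (\<forall>s\<in>{a..b}. \<forall>t\<in>{a..b}.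
        \<bar>s - t\<bar> / K - A \<le> dist (q s) (q t) \<and> dist (q s) (q t) \<le> K * \<bar>s - t\<bar> + A)"

definition morse_ray :: "(real \<Rightarrow> 'a::metric_space) \<Rightarrow> bool" where
  "morse_ray \<gamma> \<longleftrightarrow> geodesic_ray \<gamma> \<and>
     (\<exists>\<phi>::real \<Rightarrow> real \<Rightarrow> real. (\<forall>K A. \<phi> K A \<ge> 0) \<and>
        (\<forall>K A a b q. K \<ge> 1 \<longrightarrow> A \<ge> 0 \<longrightarrow> quasi_geodesic K A a b q \<longrightarrow>
           q a \<in> \<gamma> ` {0..} \<longrightarrow> q b \<in> \<gamma> ` {0..} \<longrightarrow>
           (\<forall>s\<in>{a..b}. \<exists>t\<ge>0. dist (q s) (\<gamma> t) \<le> \<phi> K A)))"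

definition finite_hausdorff :: "(real \<Rightarrow> 'a::metric_space) \<Rightarrow> (real \<Rightarrow> 'a) \<Rightarrow> bool" where
  "finite_hausdorff \<gamma> \<delta> \<longleftrightarrow> (\<exists>C. (\<forall>s\<ge>0. \<exists>t\<ge>0. dist (\<gamma> s) (\<delta> t) \<le> C) \<and>
                                   (\<forall>t\<ge>0. \<exists>s\<ge>0. dist (\<delta> t) (\<gamma> s) \<le> C))"

definition morse_rel :: "((real \<Rightarrow> 'a::metric_space) \<times> (real \<Rightarrow> 'a)) set" where
  "morse_rel = {(\<gamma>, \<delta>). morse_ray \<gamma> \<and> morse_ray \<delta> \<and> finite_hausdorff \<gamma> \<delta>}"

definition morse_boundary :: "'a::metric_space itself \<Rightarrow> (real \<Rightarrow> 'a) set set" where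
  "morse_boundary _ = {\<gamma>. morse_ray \<gamma>} // morse_rel"

definition quasi_isometry :: "real \<Rightarrow> real \<Rightarrow> ('a::metric_space \<Rightarrow> 'a) \<Rightarrow> bool" where
  "quasi_isometry K A f \<longleftrightarrow>
     (\<forall>x y. dist x y / K - A \<le> dist (f x) (f y) \<and> dist (f x) (f y) \<le> K * dist x y + A) \<and>
     (\<forall>y. \<exists>x. dist (f x) y \<le> A)"

definition quasi_action ::
  "('g, 'b) monoid_scheme \<Rightarrow> ('g \<Rightarrow> 'a::metric_space \<Rightarrow> 'a) \<Rightarrow> real \<Rightarrow> real \<Rightarrow> bool" where
  "quasi_action G act K A \<longleftrightarrow> K \<ge> 1 \<and> A \<ge> 0 \<and>
     (\<forall>g\<in>carrier G. quasi_isometry K A (act g)) \<and>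
     (\<forall>g\<in>carrier G. \<forall>h\<in>carrier G. \<forall>x. dist (act h (act g x)) (act (h \<otimes>\<^bsub>G\<^esub> g) x) \<le> A) \<and>
     (\<forall>x. dist (act \<one>\<^bsub>G\<^esub> x) x \<le> A)"

definition cobounded_qa :: "('g, 'b) monoid_scheme \<Rightarrow> ('g \<Rightarrow> 'a::metric_space \<Rightarrow> 'a) \<Rightarrow> bool" where
  "cobounded_qa G act \<longleftrightarrow> (\<exists>r. \<forall>x y. \<exists>g\<in>carrier G. dist (act g x) y \<le> r)"

text \<open>T \<subseteq> G is bounded if its orbit of a basepoint is bounded
  (independent of the basepoint for a quasi-action).\<close>
definition qa_bounded :: "('g \<Rightarrow> 'a::metric_space \<Rightarrow> 'a) \<Rightarrow> 'g set \<Rightarrow> bool" where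
  "qa_bounded act T \<longleftrightarrow> (\<exists>x0. bounded ((\<lambda>t. act t x0) ` T))"

definition topological_group :: "('h, 'c) monoid_scheme \<Rightarrow> 'h topology \<Rightarrow> bool" where
  "topological_group H \<tau> \<longleftrightarrow> group H \<and> topspace \<tau> = carrier H \<and>
     continuous_map (prod_topology \<tau> \<tau>) \<tau> (\<lambda>(x, y). x \<otimes>\<^bsub>H\<^esub> y) \<and>
     continuous_map \<tau> \<tau> (\<lambda>x. inv\<^bsub>H\<^esub> x)"

definition topological_completion ::
  "('g, 'b) monoid_scheme \<Rightarrow> ('g \<Rightarrow> 'a::metric_space \<Rightarrow> 'a) \<Rightarrow>
   ('h, 'c) monoid_scheme \<Rightarrow> 'h topology \<Rightarrow> ('g \<Rightarrow> 'h) \<Rightarrow> bool" where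
  "topological_completion G act H \<tau> \<rho> \<longleftrightarrow>
     topological_group H \<tau> \<and> Hausdorff_space \<tau> \<and> locally_compact_space \<tau> \<and>
     \<rho> \<in> hom G H \<and>
     \<tau> closure_of (\<rho> ` carrier G) = topspace \<tau> \<and>
     (\<forall>T \<subseteq> carrier G. qa_bounded act T \<longleftrightarrow> compactin \<tau> (\<tau> closure_of (\<rho> ` T)))"

end

theory Submission
  imports Defs
begin

text \<open>
  The key point is that \<open>X\<close> is tame in a local form: a quasi-isometry \<open>f\<close> moving every point of a
  large ball around \<open>y\<close> by at most \<open>S\<close> moves \<open>y\<close> by at most a constant independent of \<open>S\<close>. Take Morse
  rays \<open>\<alpha>, \<beta>, \<gamma>\<close> from \<open>x\<close> representing three boundary points. Then \<open>\<alpha> \<union> \<beta>\<close> is a quasi-geodesic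
  line; cutting its image under \<open>f\<close> at a point nearest to \<open>x\<close> and joining the far part to \<open>\<alpha>\<close> (or \<open>\<beta>\<close>)
  by a shortest geodesic gives a quasi-geodesic whose constants do not involve \<open>S\<close>, so the Morse
  property puts \<open>f x\<close> near \<open>\<alpha>\<close> or \<open>\<beta>\<close>. Applied to the three pairs of rays, \<open>f x\<close> is near two
  divergent rays and hence near \<open>x\<close>; cocompactness transports this to all \<open>y\<close>.

  Tameness makes the sets of group elements that almost fix larger and larger balls a basis of
  neighbourhoods of the identity for a group topology on \<open>G\<close>, because products and conjugates of
  almost-fixing elements fix slightly smaller balls with the original constant. By properness, bounded
  sets are exactly the precompact ones, and the Hausdorff completion of \<open>G\<close> is the required group.
\<close>

section \<open>Concatenating quasi-geodesics\<close>

text \<open>The order of quantifiers in tameness carries the argument: the bound \<open>B\<close> is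
  fixed first, and only the radius \<open>R\<close> depends on \<open>S\<close>. Thus
  \<open>S\<close> can later be chosen as an expression in \<open>B\<close>, \<open>K\<close> and
  \<open>A\<close> that exceeds every displacement produced by multiplying or conjugating elements
  of displacement at most \<open>B\<close>; accumulated error is traded for a loss of radius. The
  independence from \<open>S\<close> comes from surgery: a geodesic of any length, attached at a
  nearest point, changes the quasi-geodesic constants by a fixed amount. Quasi-geodesics may jump,
  so nearest points are taken up to an error of 1.

  A quasi-action gives no homomorphism into a group of maps of the space, so there is no ambient
  group in which to take a closure, and the completion is built from sequences in \<open>G\<close>.
  In a general group, inverses of sequences that are Cauchy for the left uniformity need not be
  Cauchy; here they are, because the effect of conjugating by an element is controlled by how far it
  moves \<open>x0\<close>, which is bounded along each Cauchy sequence.\<close>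

lemma near_minimum_exists:
  fixes f :: "'b \<Rightarrow> real"
  assumes "S \<noteq> {}" and "\<And>s. 0 \<le> f s"
  obtains s where "s \<in> S" "\<And>t. t \<in> S \<Longrightarrow> f s \<le> f t + 1"
proof -
  have bdd: "bdd_below (f ` S)" using assms(2) by (auto intro: bdd_belowI[of _ 0])
  have "Inf (f ` S) < Inf (f ` S) + 1" by simp
  then obtain s where "s \<in> S" "f s < Inf (f ` S) + 1"
    using assms(1) bdd by (subst (asm) cInf_less_iff) auto
  moreover have "Inf (f ` S) \<le> f t" if "t \<in> S" for t
    using that bdd by (auto intro: cInf_lower)
  ultimately show ?thesis by (intro that[of s]) (auto intro: less_imp_le order_trans add_right_mono)
qed

lemma quasi_geodesicD:
  assumes "quasi_geodesic K A a b q" "s \<in> {a..b}" "t \<in> {a..b}"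
  shows "\<bar>s - t\<bar> / K - A \<le> dist (q s) (q t)" "dist (q s) (q t) \<le> K * \<bar>s - t\<bar> + A"
  using assms by (simp_all add: quasi_geodesic_def)

lemma quasi_geodesic_perturb:
  assumes q: "quasi_geodesic K A a b q" and D: "\<And>s. s \<in> {a..b} \<Longrightarrow> dist (p s) (q s) \<le> D"
  shows "quasi_geodesic K (A + 2 * D) a b p"
  unfolding quasi_geodesic_def
proof (intro conjI ballI)
  show "a \<le> b" using q by (simp add: quasi_geodesic_def)
  fix s t assume st: "s \<in> {a..b}" "t \<in> {a..b}"
  have "dist (q s) (q t) \<le> dist (p s) (p t) + 2 * D"
    using D[OF st(1)] D[OF st(2)] dist_triangle[of "q s" "q t" "p s"] dist_triangle[of "p s" "q t" "p t"]
    by (simp add: dist_commute)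
  then show "\<bar>s - t\<bar> / K - (A + 2 * D) \<le> dist (p s) (p t)"
    using quasi_geodesicD[OF q st] by linarith
  have "dist (p s) (p t) \<le> dist (q s) (q t) + 2 * D"
    using D[OF st(1)] D[OF st(2)] dist_triangle[of "p s" "p t" "q s"] dist_triangle[of "q s" "p t" "q t"]
    by (simp add: dist_commute)
  then show "dist (p s) (p t) \<le> K * \<bar>s - t\<bar> + (A + 2 * D)"
    using quasi_geodesicD[OF q st] by linarith
qed

lemma quasi_geodesic_subinterval:
  assumes "quasi_geodesic K A a b q" "a \<le> a'" "a' \<le> b'" "b' \<le> b"
  shows "quasi_geodesic K A a' b' q"
  using assms by (auto simp: quasi_geodesic_def)

lemma quasi_geodesic_reverse:
  assumes "quasi_geodesic K A a b q"
  shows "quasi_geodesic K A (- b) (- a) (\<lambda>s. q (- s))"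
  unfolding quasi_geodesic_def
proof (intro conjI ballI)
  fix s t assume "s \<in> {- b..- a}" "t \<in> {- b..- a}"
  then have "- s \<in> {a..b}" "- t \<in> {a..b}" by auto
  moreover have "\<bar>- s - - t\<bar> = \<bar>s - t\<bar>" by simp
  ultimately show "\<bar>s - t\<bar> / K - A \<le> dist (q (- s)) (q (- t))"
    "dist (q (- s)) (q (- t)) \<le> K * \<bar>s - t\<bar> + A"
    using assms unfolding quasi_geodesic_def by metis+
qed (use assms in \<open>simp add: quasi_geodesic_def\<close>)

lemma quasi_geodesicI_less:
  assumes "a \<le> b" "0 \<le> A"
    and "\<And>s t. a \<le> s \<Longrightarrow> s < t \<Longrightarrow> t \<le> b \<Longrightarrow>
      (t - s) / K - A \<le> dist (q s) (q t) \<and> dist (q s) (q t) \<le> K * (t - s) + A"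
  shows "quasi_geodesic K A a b q"
  unfolding quasi_geodesic_def
proof (intro conjI ballI)
  fix s t assume st: "s \<in> {a..b}" "t \<in> {a..b}"
  consider "s < t" | "t < s" | "s = t" by linarith
  then have "\<bar>s - t\<bar> / K - A \<le> dist (q s) (q t) \<and> dist (q s) (q t) \<le> K * \<bar>s - t\<bar> + A"
  proof cases
    case 1 then show ?thesis using assms(3)[of s t] st by auto
  next
    case 2 then show ?thesis using assms(3)[of t s] st by (auto simp: dist_commute)
  next
    case 3 then show ?thesis using assms(2) by simp
  qed
  then show "\<bar>s - t\<bar> / K - A \<le> dist (q s) (q t)" "dist (q s) (q t) \<le> K * \<bar>s - t\<bar> + A" by auto
qed fact

text \<open>The constants do not see the length of the attached geodesic. A point of it at distance
  \<open>\<tau>\<close> from \<open>q b\<close> has distance \<open>l - \<tau>\<close> from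
  \<open>x\<close>, while every point of \<open>q\<close> has distance at least
  \<open>l - 1\<close>; hence the gap \<open>d\<close> across the corner satisfies
  \<open>\<tau> \<le> d + 1\<close>, and neither branch can double back along the other.\<close>

lemma quasi_geodesic_append:
  fixes q :: "real \<Rightarrow> 'a::metric_space"
  assumes geod: "geodesic_space TYPE('a)" and k: "k \<ge> 1" and c: "c \<ge> 0"
    and q: "quasi_geodesic k c a b q"
    and near: "\<And>s. s \<in> {a..b} \<Longrightarrow> dist x (q b) \<le> dist x (q s) + 1"
  obtains p where "quasi_geodesic (3 * k) (c + 1) a (b + dist x (q b)) p"
    "\<And>s. s \<in> {a..b} \<Longrightarrow> p s = q s" "p (b + dist x (q b)) = x"
    "\<And>s. s \<in> {b..b + dist x (q b)} \<Longrightarrow> dist (p s) (q b) \<le> dist x (q b)"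
proof -
  define l where "l = dist x (q b)"
  obtain g where g: "g 0 = q b" "g l = x"
    and iso: "\<And>s t. s \<in> {0..l} \<Longrightarrow> t \<in> {0..l} \<Longrightarrow> dist (g s) (g t) = \<bar>s - t\<bar>"
    using geod unfolding geodesic_space_def l_def by (metis dist_commute)
  have l: "0 \<le> l" by (simp add: l_def)
  have ab: "a \<le> b" using q by (simp add: quasi_geodesic_def)
  define p where "p s = (if s \<le> b then q s else g (s - b))" for s
  have "quasi_geodesic (3 * k) (c + 1) a (b + l) p"
  proof (rule quasi_geodesicI_less)
    fix s t assume st: "a \<le> s" "s < t" "t \<le> b + l"
    consider "t \<le> b" | "s > b" | "s \<le> b" "b < t" by linarith
    then show "(t - s) / (3 * k) - (c + 1) \<le> dist (p s) (p t) \<and> dist (p s) (p t) \<le> 3 * k * (t - s) + (c + 1)"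
    proof cases
      case 1
      have "(t - s) / k - c \<le> dist (q s) (q t)" "dist (q s) (q t) \<le> k * (t - s) + c"
        using quasi_geodesicD[OF q, of s t] st 1 by auto
      moreover have "(t - s) / (3 * k) \<le> (t - s) / k" using k st by (intro divide_left_mono) auto
      moreover have "k * (t - s) \<le> 3 * k * (t - s)" using k st by (intro mult_right_mono) auto
      ultimately show ?thesis using 1 st by (simp add: p_def)
    next
      case 2
      have d: "dist (p s) (p t) = t - s" using 2 st iso[of "s - b" "t - b"] by (simp add: p_def)
      have "(t - s) / (3 * k) \<le> t - s" using k st by (simp add: divide_le_eq)
      moreover have "1 * (t - s) \<le> 3 * k * (t - s)" using k st by (intro mult_right_mono) auto
      ultimately show ?thesis using d c by auto
    next
      case 3
      define \<tau> where "\<tau> = t - b"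
      define d where "d = dist (q s) (g \<tau>)"
      have \<tau>: "0 < \<tau>" "\<tau> \<le> l" using 3 st by (auto simp: \<tau>_def)
      have u: "dist (g \<tau>) (q b) = \<tau>" using iso[of \<tau> 0] \<tau> g by simp
      have ux: "dist (g \<tau>) x = l - \<tau>" using iso[of \<tau> l] \<tau> g by simp
      have lo: "(b - s) / k - c \<le> dist (q s) (q b)" and up: "dist (q s) (q b) \<le> k * (b - s) + c"
        using quasi_geodesicD[OF q, of s b] st 3 by auto
      have "l \<le> dist x (q s) + 1" using near[of s] st 3 by (simp add: l_def)
      then have td: "\<tau> \<le> d + 1"
        using ux dist_triangle[of x "q s" "g \<tau>"] by (simp add: d_def dist_commute)
      have "dist (q s) (q b) \<le> d + \<tau>"
        using u dist_triangle[of "q s" "q b" "g \<tau>"] by (simp add: d_def)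
      \<comment> \<open>Uses \<open>\<tau> \<le> d + 1\<close> twice. Division by 3 leaves
        \<open>d + (c + 2) / 3\<close> on the right, which is the origin of the factor 3 and of the
        additive \<open>c + 1\<close>.\<close>
      then have "(b - s) / k + \<tau> \<le> 3 * d + 2 + c" using lo td by linarith
      moreover have "\<tau> / k \<le> \<tau>" using k \<tau> by (simp add: divide_le_eq)
      moreover have "(t - s) / k = (b - s) / k + \<tau> / k" by (simp add: \<tau>_def add_divide_distrib[symmetric])
      ultimately have "(t - s) / k \<le> 3 * d + 2 + c" by linarith
      moreover have "(t - s) / (3 * k) = (t - s) / k / 3" by simp
      ultimately have A: "(t - s) / (3 * k) - (c + 1) \<le> d" using c by linarith
      have "d \<le> dist (q s) (q b) + \<tau>"
        using u dist_triangle[of "q s" "g \<tau>" "q b"] by (simp add: d_def dist_commute)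
      also have "\<dots> \<le> k * (b - s) + c + k * \<tau>"
        using up k \<tau> mult_right_mono[of 1 k \<tau>] by linarith
      also have "\<dots> = k * (t - s) + c" by (simp add: \<tau>_def algebra_simps)
      also have "k * (t - s) \<le> 3 * k * (t - s)" using k st by (intro mult_right_mono) auto
      finally have "d \<le> 3 * k * (t - s) + (c + 1)" by simp
      moreover have "dist (p s) (p t) = d" using 3 by (simp add: p_def d_def \<tau>_def)
      ultimately show ?thesis using A by simp
    qed
  qed (use ab l c in auto)
  moreover have "p s = q s" if "s \<in> {a..b}" for s using that by (simp add: p_def)
  moreover have "p (b + l) = x"
    using g l by (cases "l = 0") (auto simp: p_def)
  moreover have "dist (p s) (q b) \<le> l" if "s \<in> {b..b + l}" for s
    using that iso[of "s - b" 0] g l by (cases "s = b") (auto simp: p_def)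
  ultimately show ?thesis using that by (simp add: l_def)
qed

lemma quasi_geodesic_prepend:
  fixes q :: "real \<Rightarrow> 'a::metric_space"
  assumes geod: "geodesic_space TYPE('a)" and k: "k \<ge> 1" and c: "c \<ge> 0"
    and q: "quasi_geodesic k c a b q"
    and near: "\<And>s. s \<in> {a..b} \<Longrightarrow> dist x (q a) \<le> dist x (q s) + 1"
  obtains p where "quasi_geodesic (3 * k) (c + 1) (a - dist x (q a)) b p"
    "\<And>s. s \<in> {a..b} \<Longrightarrow> p s = q s" "p (a - dist x (q a)) = x"
    "\<And>s. s \<in> {a - dist x (q a)..a} \<Longrightarrow> dist (p s) (q a) \<le> dist x (q a)"
proof -
  obtain p where p: "quasi_geodesic (3 * k) (c + 1) (- b) (- a + dist x (q (- (- a)))) p"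
    "\<And>s. s \<in> {- b..- a} \<Longrightarrow> p s = q (- s)" "p (- a + dist x (q (- (- a)))) = x"
    "\<And>s. s \<in> {- a..- a + dist x (q (- (- a)))} \<Longrightarrow> dist (p s) (q (- (- a))) \<le> dist x (q (- (- a)))"
    using quasi_geodesic_append[OF geod k c quasi_geodesic_reverse[OF q], of x] near by auto
  show ?thesis
  proof (rule that[of "\<lambda>s. p (- s)"])
    show "quasi_geodesic (3 * k) (c + 1) (a - dist x (q a)) b (\<lambda>s. p (- s))"
      using quasi_geodesic_reverse[OF p(1)] by simp
  qed (use p in auto)
qed

section \<open>Morse rays\<close>

text \<open>A Morse ray whose initial point is moved to \<open>x\<close>, so that several rays share a basepoint; it
  remains geodesic up to the additive error \<open>D\<close>.\<close>
definition coarse_morse_ray :: "'a::metric_space \<Rightarrow> real \<Rightarrow> (real \<Rightarrow> 'a) \<Rightarrow> bool" where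
  "coarse_morse_ray x D \<alpha> \<longleftrightarrow> \<alpha> 0 = x \<and> 0 \<le> D \<and> (\<forall>b\<ge>0. quasi_geodesic 1 D 0 b \<alpha>) \<and>
     (\<forall>K\<ge>1. \<forall>A\<ge>0. \<exists>C. \<forall>a b q. quasi_geodesic K A a b q \<longrightarrow> q a \<in> \<alpha> ` {0..} \<longrightarrow> q b \<in> \<alpha> ` {0..} \<longrightarrow>
        (\<forall>s\<in>{a..b}. \<exists>t\<ge>0. dist (q s) (\<alpha> t) \<le> C))"

lemma coarse_morse_ray_dist:
  assumes "coarse_morse_ray x D \<alpha>" "0 \<le> s" "0 \<le> t"
  shows "\<bar>dist (\<alpha> s) (\<alpha> t) - \<bar>s - t\<bar>\<bar> \<le> D"
proof -
  have "quasi_geodesic 1 D 0 (max s t) \<alpha>" using assms by (auto simp: coarse_morse_ray_def)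
  from quasi_geodesicD[OF this, of s t] show ?thesis using assms(2,3) by (simp add: abs_le_iff)
qed

lemma coarse_morse_ray_gauge:
  assumes "coarse_morse_ray x D \<alpha>" "K \<ge> 1" "A \<ge> 0"
  obtains C where "\<And>a b q s. quasi_geodesic K A a b q \<Longrightarrow> q a \<in> \<alpha> ` {0..} \<Longrightarrow> q b \<in> \<alpha> ` {0..} \<Longrightarrow>
     s \<in> {a..b} \<Longrightarrow> \<exists>t\<ge>0. dist (q s) (\<alpha> t) \<le> C"
proof -
  from assms obtain C where "\<forall>a b q. quasi_geodesic K A a b q \<longrightarrow> q a \<in> \<alpha> ` {0..} \<longrightarrow> q b \<in> \<alpha> ` {0..} \<longrightarrow>
        (\<forall>s\<in>{a..b}. \<exists>t\<ge>0. dist (q s) (\<alpha> t) \<le> C)"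
    unfolding coarse_morse_ray_def by blast
  then show ?thesis by (intro that[of C]) simp
qed

lemma morse_ray_gauge:
  assumes "morse_ray \<gamma>" "K \<ge> 1" "A \<ge> 0"
  obtains C where "\<And>a b q s. quasi_geodesic K A a b q \<Longrightarrow> q a \<in> \<gamma> ` {0..} \<Longrightarrow> q b \<in> \<gamma> ` {0..} \<Longrightarrow>
     s \<in> {a..b} \<Longrightarrow> \<exists>t\<ge>0. dist (q s) (\<gamma> t) \<le> C"
proof -
  from assms obtain \<phi> :: "real \<Rightarrow> real \<Rightarrow> real" where
    "\<forall>K A a b q. K \<ge> 1 \<longrightarrow> A \<ge> 0 \<longrightarrow> quasi_geodesic K A a b q \<longrightarrow>
      q a \<in> \<gamma> ` {0..} \<longrightarrow> q b \<in> \<gamma> ` {0..} \<longrightarrow> (\<forall>s\<in>{a..b}. \<exists>t\<ge>0. dist (q s) (\<gamma> t) \<le> \<phi> K A)"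
    unfolding morse_ray_def by blast
  then show ?thesis using assms(2,3) by (intro that[of "\<phi> K A"]) simp
qed

lemma geodesic_ray_quasi_geodesic:
  assumes "geodesic_ray \<gamma>" "0 \<le> a" "a \<le> b" shows "quasi_geodesic 1 0 a b \<gamma>"
  using assms by (auto simp: quasi_geodesic_def geodesic_ray_def)

lemma coarse_morse_ray_rebase:
  assumes "morse_ray \<gamma>"
  shows "coarse_morse_ray x (2 * dist x (\<gamma> 0)) (\<lambda>t. if t = 0 then x else \<gamma> t)"
proof -
  define D where "D = dist x (\<gamma> 0)"
  define \<alpha> where "\<alpha> = (\<lambda>t. if t = 0 then x else \<gamma> t)"
  have near: "dist (\<alpha> t) (\<gamma> t) \<le> D" for t by (simp add: \<alpha>_def D_def)
  have geo: "geodesic_ray \<gamma>" using assms by (simp add: morse_ray_def)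
  have "\<exists>C. \<forall>a b q. quasi_geodesic K A a b q \<longrightarrow> q a \<in> \<alpha> ` {0..} \<longrightarrow> q b \<in> \<alpha> ` {0..} \<longrightarrow>
        (\<forall>s\<in>{a..b}. \<exists>t\<ge>0. dist (q s) (\<alpha> t) \<le> C)" if K: "K \<ge> 1" and A: "A \<ge> 0" for K A
  proof -
    have "A + 2 * D \<ge> 0" using A by (simp add: D_def)
    then obtain C where C: "\<And>a b q s. quasi_geodesic K (A + 2 * D) a b q \<Longrightarrow> q a \<in> \<gamma> ` {0..} \<Longrightarrow>
        q b \<in> \<gamma> ` {0..} \<Longrightarrow> s \<in> {a..b} \<Longrightarrow> \<exists>t\<ge>0. dist (q s) (\<gamma> t) \<le> C"
      using morse_ray_gauge[OF assms K] by blast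
    show ?thesis
    proof (rule exI[of _ "D + C + D"], intro allI impI ballI)
      fix a b q s assume q: "quasi_geodesic K A a b q" "q a \<in> \<alpha> ` {0..}" "q b \<in> \<alpha> ` {0..}"
        and s: "s \<in> {a..b}"
      \<comment> \<open>A quasi-geodesic with ends on the rebased ray may end at \<open>x\<close>,
        which need not lie on \<open>\<gamma>\<close>. Sending the value \<open>x\<close> to
        \<open>\<gamma> 0\<close> restores ends on \<open>\<gamma>\<close>, at the price of
        \<open>2 * D\<close> in the additive constant.\<close>
      define q' where "q' = (\<lambda>s. if q s = x then \<gamma> 0 else q s)"
      have q': "dist (q' s) (q s) \<le> D" for s by (auto simp: q'_def D_def dist_commute)
      have "quasi_geodesic K (A + 2 * D) a b q'" using quasi_geodesic_perturb[OF q(1)] q' by blast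
      moreover have "q' a \<in> \<gamma> ` {0..}" "q' b \<in> \<gamma> ` {0..}" using q(2,3) by (auto simp: q'_def \<alpha>_def)
      ultimately obtain t where t: "t \<ge> 0" "dist (q' s) (\<gamma> t) \<le> C" using C s by blast
      have "dist (q s) (\<alpha> t) \<le> D + C + D"
        using t(2) q'[of s] near[of t] dist_triangle[of "q s" "\<alpha> t" "q' s"] dist_triangle[of "q' s" "\<alpha> t" "\<gamma> t"]
        by (simp add: dist_commute)
      then show "\<exists>t\<ge>0. dist (q s) (\<alpha> t) \<le> D + C + D" using t(1) by blast
    qed
  qed
  moreover have "quasi_geodesic 1 (2 * D) 0 b \<alpha>" if "b \<ge> 0" for b
    using quasi_geodesic_perturb[OF geodesic_ray_quasi_geodesic[OF geo order.refl that], of \<alpha> D] near by simp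
  moreover have "\<alpha> 0 = x" "0 \<le> 2 * D" by (simp_all add: \<alpha>_def D_def)
  ultimately have "coarse_morse_ray x (2 * D) \<alpha>" unfolding coarse_morse_ray_def by blast
  then show ?thesis by (simp add: D_def \<alpha>_def)
qed

section \<open>Diverging rays, from qualitative to linear divergence\<close>

definition diverging :: "(real \<Rightarrow> 'a::metric_space) \<Rightarrow> (real \<Rightarrow> 'a) \<Rightarrow> bool" where
  "diverging \<alpha> \<beta> \<longleftrightarrow> (\<forall>C. \<exists>M. \<forall>s\<ge>0. \<forall>t\<ge>0. dist (\<alpha> s) (\<beta> t) \<le> C \<longrightarrow> s \<le> M \<and> t \<le> M)"

lemma diverging_rebase:
  assumes "diverging \<alpha> \<beta>"
  shows "diverging (\<lambda>t. if t = 0 then x else \<alpha> t) (\<lambda>t. if t = 0 then x else \<beta> t)"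
  unfolding diverging_def
proof
  fix C
  define D where "D = dist x (\<alpha> 0) + dist x (\<beta> 0)"
  obtain M where M: "\<And>s t. s \<ge> 0 \<Longrightarrow> t \<ge> 0 \<Longrightarrow> dist (\<alpha> s) (\<beta> t) \<le> C + D \<Longrightarrow> s \<le> M \<and> t \<le> M"
    using assms unfolding diverging_def by meson
  have "dist (\<alpha> s) (\<beta> t) \<le> dist (if s = 0 then x else \<alpha> s) (if t = 0 then x else \<beta> t) + D" for s t
  proof -
    define a b where "a = (if s = 0 then x else \<alpha> s)" and "b = (if t = 0 then x else \<beta> t)"
    have "dist (\<alpha> s) a \<le> dist x (\<alpha> 0)" "dist b (\<beta> t) \<le> dist x (\<beta> 0)"
      by (auto simp: a_def b_def dist_commute)
    then have "dist (\<alpha> s) (\<beta> t) \<le> dist a b + D"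
      using dist_triangle[of "\<alpha> s" "\<beta> t" a] dist_triangle[of a "\<beta> t" b] by (simp add: D_def)
    then show ?thesis by (simp add: a_def b_def)
  qed
  then show "\<exists>M. \<forall>s\<ge>0. \<forall>t\<ge>0. dist (if s = 0 then x else \<alpha> s) (if t = 0 then x else \<beta> t) \<le> C \<longrightarrow> s \<le> M \<and> t \<le> M"
    using M by (intro exI[of _ M]) (meson add_right_mono order_trans)
qed

text \<open>A late point of \<open>\<beta>\<close> near \<open>\<alpha>\<close> lets an initial
  segment of \<open>\<beta>\<close> be pinned to \<open>\<alpha>\<close> at both ends by moving two
  points. The Morse bound for \<open>\<alpha>\<close> then confines that segment, with a constant
  independent of its length.\<close>

lemma morse_ray_neighbourhood:
  assumes \<alpha>: "morse_ray \<alpha>" and \<beta>: "geodesic_ray \<beta>"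
    and far: "\<And>M. \<exists>s\<ge>0. \<exists>t\<ge>M. dist (\<alpha> s) (\<beta> t) \<le> C"
  shows "\<exists>C'. \<forall>u\<ge>0. \<exists>v\<ge>0. dist (\<beta> u) (\<alpha> v) \<le> C'"
proof -
  define D where "D = \<bar>C\<bar> + dist (\<alpha> 0) (\<beta> 0)"
  have D: "D \<ge> 0" by (simp add: D_def)
  obtain C' where C': "\<And>a b q s. quasi_geodesic 1 (2 * D) a b q \<Longrightarrow> q a \<in> \<alpha> ` {0..} \<Longrightarrow>
        q b \<in> \<alpha> ` {0..} \<Longrightarrow> s \<in> {a..b} \<Longrightarrow> \<exists>t\<ge>0. dist (q s) (\<alpha> t) \<le> C'"
    using morse_ray_gauge[OF \<alpha>, of 1 "2 * D"] D by auto
  have "\<exists>v\<ge>0. dist (\<beta> u) (\<alpha> v) \<le> D + C'" if u: "u \<ge> 0" for u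
  proof -
    obtain s t where st: "s \<ge> 0" "t \<ge> u + 1" "dist (\<alpha> s) (\<beta> t) \<le> C" using far by blast
    define q where "q = (\<lambda>r. if r = 0 then \<alpha> 0 else if r = t then \<alpha> s else \<beta> r)"
    have qb: "dist (q r) (\<beta> r) \<le> D" for r 
    proof -
      have "dist (\<alpha> s) (\<beta> t) \<le> D" "dist (\<alpha> 0) (\<beta> 0) \<le> D"
        using st(3) zero_le_dist[of "\<alpha> 0" "\<beta> 0"] abs_ge_self[of C] unfolding D_def by linarith+
      then show ?thesis using D by (simp add: q_def)
    qed
    have "quasi_geodesic 1 (2 * D) 0 t q"
      using quasi_geodesic_perturb[OF geodesic_ray_quasi_geodesic[OF \<beta>, of 0 t], of q D] qb st u by simp
    moreover have "q 0 \<in> \<alpha> ` {0..}" "q t \<in> \<alpha> ` {0..}" using st u by (auto simp: q_def)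
    ultimately obtain v where v: "v \<ge> 0" "dist (q u) (\<alpha> v) \<le> C'" using C'[of 0 t q u] st u by auto
    then have "dist (\<beta> u) (\<alpha> v) \<le> D + C'"
      using qb[of u] dist_triangle[of "\<beta> u" "\<alpha> v" "q u"] by (simp add: dist_commute)
    then show ?thesis using v by blast
  qed
  then show ?thesis by blast
qed

text \<open>The parameter on a geodesic ray is the distance from its origin. When divergence fails,
  only one of the two parameters is known to be large; this estimate makes the other one large as
  well.\<close>

lemma geodesic_rays_close_parameters:
  assumes "geodesic_ray \<alpha>" "geodesic_ray \<beta>" "0 \<le> s" "0 \<le> t"
  shows "\<bar>s - t\<bar> \<le> dist (\<alpha> s) (\<beta> t) + dist (\<alpha> 0) (\<beta> 0)"
proof -
  have "dist (\<alpha> 0) (\<alpha> s) = s" "dist (\<beta> 0) (\<beta> t) = t"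
    using assms unfolding geodesic_ray_def by force+
  then show ?thesis
    using dist_triangle[of "\<alpha> 0" "\<alpha> s" "\<beta> 0"] dist_triangle[of "\<beta> 0" "\<alpha> s" "\<beta> t"]
      dist_triangle[of "\<beta> 0" "\<beta> t" "\<alpha> 0"] dist_triangle[of "\<alpha> 0" "\<beta> t" "\<alpha> s"]
    by (simp add: dist_commute)
qed

lemma morse_rays_diverging:
  assumes \<alpha>: "morse_ray \<alpha>" and \<beta>: "morse_ray \<beta>" and not: "\<not> finite_hausdorff \<alpha> \<beta>"
  shows "diverging \<alpha> \<beta>"
proof (rule ccontr)
  assume "\<not> diverging \<alpha> \<beta>"
  then obtain C where C: "\<And>M. \<exists>s\<ge>0. \<exists>t\<ge>0. dist (\<alpha> s) (\<beta> t) \<le> C \<and> (s > M \<or> t > M)"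
    unfolding diverging_def by (meson not_le)
  have geo: "geodesic_ray \<alpha>" "geodesic_ray \<beta>" using \<alpha> \<beta> by (auto simp: morse_ray_def)
  have both: "\<exists>s\<ge>0. \<exists>t\<ge>0. dist (\<alpha> s) (\<beta> t) \<le> C \<and> s \<ge> M \<and> t \<ge> M" for M
  proof -
    obtain s t where st: "s \<ge> 0" "t \<ge> 0" "dist (\<alpha> s) (\<beta> t) \<le> C"
      and or: "s > M + C + dist (\<alpha> 0) (\<beta> 0) \<or> t > M + C + dist (\<alpha> 0) (\<beta> 0)" using C by blast
    have "0 \<le> C" using st(3) zero_le_dist order_trans by blast
    then have "s \<ge> M" "t \<ge> M"
      using geodesic_rays_close_parameters[OF geo st(1,2)] or st(3) zero_le_dist[of "\<alpha> 0" "\<beta> 0"] by linarith+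
    then show ?thesis using st by blast
  qed
  obtain C1 where C1: "\<forall>u\<ge>0. \<exists>v\<ge>0. dist (\<beta> u) (\<alpha> v) \<le> C1"
    using morse_ray_neighbourhood[OF \<alpha> geo(2), of C] both by blast
  have "\<exists>s\<ge>0. \<exists>t\<ge>M. dist (\<beta> s) (\<alpha> t) \<le> C" for M using both[of M] by (metis dist_commute)
  then obtain C2 where C2: "\<forall>u\<ge>0. \<exists>v\<ge>0. dist (\<alpha> u) (\<beta> v) \<le> C2"
    using morse_ray_neighbourhood[OF \<beta> geo(1), of C] by blast
  have "finite_hausdorff \<alpha> \<beta>" unfolding finite_hausdorff_def
    using C1 C2 by (intro exI[of _ "max C1 C2"]) (meson max.coboundedI1 max.coboundedI2)
  then show False using not by simp
qed

text \<open>The curve that follows \<open>\<alpha>\<close> to a nearest point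
  \<open>\<alpha> s0\<close> of \<open>\<beta> t\<close> and then a geodesic has both ends on
  \<open>\<beta>\<close>, as the rays share \<open>x\<close>. The Morse property of
  \<open>\<beta>\<close> keeps \<open>\<alpha> s0\<close> near \<open>\<beta>\<close>, and
  divergence bounds \<open>s0\<close>. So \<open>\<beta> t\<close> projects near \<open>x\<close>,
  uniformly in \<open>t\<close>, and linear growth follows from the triangle inequality.\<close>

lemma diverging_linear:
  fixes \<alpha> \<beta> :: "real \<Rightarrow> 'a::metric_space"
  assumes geod: "geodesic_space TYPE('a)" and \<alpha>: "coarse_morse_ray x D \<alpha>" and \<beta>: "coarse_morse_ray x D \<beta>"
    and div: "diverging \<alpha> \<beta>"
  obtains c where "c \<ge> 0" "\<And>s t. s \<ge> 0 \<Longrightarrow> t \<ge> 0 \<Longrightarrow> (s + t) / 3 - c \<le> dist (\<alpha> s) (\<beta> t)"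
proof -
  have D: "D \<ge> 0" "\<alpha> 0 = x" "\<beta> 0 = x" using \<alpha> \<beta> by (auto simp: coarse_morse_ray_def)
  obtain C where C: "\<And>a b q s. quasi_geodesic 3 (D + 1) a b q \<Longrightarrow> q a \<in> \<beta> ` {0..} \<Longrightarrow> q b \<in> \<beta> ` {0..} \<Longrightarrow>
     s \<in> {a..b} \<Longrightarrow> \<exists>t\<ge>0. dist (q s) (\<beta> t) \<le> C"
    using coarse_morse_ray_gauge[OF \<beta>, of 3 "D + 1"] D by auto
  obtain M where M: "\<And>s t. s \<ge> 0 \<Longrightarrow> t \<ge> 0 \<Longrightarrow> dist (\<alpha> s) (\<beta> t) \<le> C \<Longrightarrow> s \<le> M"
    using div unfolding diverging_def by meson
  have "(s + t) / 3 - (\<bar>M\<bar> + D + 1) \<le> dist (\<alpha> s) (\<beta> t)" if st: "s \<ge> 0" "t \<ge> 0" for s t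
  proof -
    obtain s0 where s0: "s0 \<in> {0..}" and min: "\<And>s. s \<in> {0..} \<Longrightarrow> dist (\<beta> t) (\<alpha> s0) \<le> dist (\<beta> t) (\<alpha> s) + 1"
      using near_minimum_exists[of "{0::real..}" "\<lambda>s. dist (\<beta> t) (\<alpha> s)"] by auto
    have "quasi_geodesic 1 D 0 s0 \<alpha>" using \<alpha> s0 by (simp add: coarse_morse_ray_def)
    then obtain p where p: "quasi_geodesic (3 * 1) (D + 1) 0 (s0 + dist (\<beta> t) (\<alpha> s0)) p"
      "\<And>s. s \<in> {0..s0} \<Longrightarrow> p s = \<alpha> s" "p (s0 + dist (\<beta> t) (\<alpha> s0)) = \<beta> t"
      using quasi_geodesic_append[OF geod order.refl D(1), of 0 s0 \<alpha> "\<beta> t" thesis] min by simp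
    have "p 0 = \<beta> 0" using p(2)[of 0] s0 D by simp
    then have "\<exists>t\<ge>0. dist (p s0) (\<beta> t) \<le> C"
      using C[of 0 "s0 + dist (\<beta> t) (\<alpha> s0)" p s0] p(1,3) s0 st by auto
    then have sM: "s0 \<le> M" using M p(2)[of s0] s0 by force
    have "dist (\<beta> t) (\<alpha> s0) \<le> dist (\<alpha> s) (\<beta> t) + 1" using min[of s] st by (simp add: dist_commute)
    moreover have "t \<le> dist (\<beta> t) x + D"
      using coarse_morse_ray_dist[OF \<beta>, of t 0] st D by (simp add: abs_le_iff)
    moreover have "dist (\<alpha> s0) x \<le> s0 + D"
      using coarse_morse_ray_dist[OF \<alpha>, of s0 0] s0 D by (simp add: abs_le_iff)
    moreover have "s - s0 \<le> dist (\<alpha> s) (\<alpha> s0) + D"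
      using coarse_morse_ray_dist[OF \<alpha>, of s s0] abs_ge_self[of "s - s0"] st s0 unfolding abs_le_iff by simp
    moreover have "dist (\<beta> t) x \<le> dist (\<beta> t) (\<alpha> s0) + dist (\<alpha> s0) x"
      "dist (\<alpha> s) (\<alpha> s0) \<le> dist (\<alpha> s) (\<beta> t) + dist (\<beta> t) (\<alpha> s0)" by (simp_all add: dist_triangle)
    \<comment> \<open>Bounding \<open>t\<close> costs one copy of the distance and bounding
      \<open>s\<close> two, since the way from \<open>\<alpha> s\<close> to
      \<open>\<alpha> s0\<close> leads through \<open>\<beta> t\<close>; the remainder is at most
      \<open>2 * s0 + 3 * D + 2\<close>.\<close>
    ultimately have "s + t \<le> 3 * dist (\<alpha> s) (\<beta> t) + 3 * (\<bar>M\<bar> + D + 1)" using sM s0 by auto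
    then show ?thesis by (simp add: field_simps)
  qed
  then show ?thesis using that[of "\<bar>M\<bar> + D + 1"] D by auto
qed

section \<open>Tameness\<close>

definition qi_embedding :: "real \<Rightarrow> real \<Rightarrow> ('a::metric_space \<Rightarrow> 'a) \<Rightarrow> bool" where
  "qi_embedding K A f \<longleftrightarrow> (\<forall>x y. dist x y / K - A \<le> dist (f x) (f y) \<and> dist (f x) (f y) \<le> K * dist x y + A)"

text \<open>A geodesic from \<open>x\<close> is attached at \<open>q a\<close>; the result is cut at
  a nearest point to \<open>\<alpha> b\<close> and closed by a second geodesic, so both ends lie on
  \<open>\<alpha>\<close>. \<open>C\<close> depends only on the constants after these two repairs
  and therefore precedes \<open>S\<close>. The bounds involving \<open>S\<close> serve only to place
  the second cut after time 0, so that \<open>q 0\<close> survives on the curve.\<close>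

lemma quasi_geodesic_captured:
  fixes \<alpha> :: "real \<Rightarrow> 'a::metric_space"
  assumes geod: "geodesic_space TYPE('a)" and \<alpha>: "coarse_morse_ray x D \<alpha>" and k: "k \<ge> 1" and c: "c \<ge> 0"
  obtains C where "\<And>S a b q. \<lbrakk>quasi_geodesic k c a b q; a \<le> 0; 0 \<le> b;
      \<And>s. s \<in> {a..b} \<Longrightarrow> dist x (q a) \<le> dist x (q s) + 1; dist x (q 0) \<le> S; dist (q b) (\<alpha> b) \<le> S;
      \<And>s. s \<in> {a..0} \<Longrightarrow> S + 1 < dist (q s) (\<alpha> b); 3 * S + 3 < dist x (\<alpha> b)\<rbrakk>
      \<Longrightarrow> \<exists>t\<ge>0. dist (q 0) (\<alpha> t) \<le> C"
proof -
  have x: "\<alpha> 0 = x" using \<alpha> by (simp add: coarse_morse_ray_def)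
  \<comment> \<open>Two repairs, each turning \<open>k\<close> into \<open>3 * k\<close> and
    \<open>c\<close> into \<open>c + 1\<close>.\<close>
  obtain C where C: "\<And>a b q s. quasi_geodesic (3 * (3 * k)) (c + 1 + 1) a b q \<Longrightarrow> q a \<in> \<alpha> ` {0..} \<Longrightarrow>
     q b \<in> \<alpha> ` {0..} \<Longrightarrow> s \<in> {a..b} \<Longrightarrow> \<exists>t\<ge>0. dist (q s) (\<alpha> t) \<le> C"
    using coarse_morse_ray_gauge[OF \<alpha>, of "3 * (3 * k)" "c + 1 + 1"] k c by auto
  show ?thesis
  proof (rule that[of C])
    fix S a b q
    assume q: "quasi_geodesic k c a b q" and ab: "a \<le> 0" "0 \<le> b"
      and near: "\<And>s. s \<in> {a..b} \<Longrightarrow> dist x (q a) \<le> dist x (q s) + 1"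
      and q0: "dist x (q 0) \<le> S" and qb: "dist (q b) (\<alpha> b) \<le> S"
      and far: "\<And>s. s \<in> {a..0} \<Longrightarrow> S + 1 < dist (q s) (\<alpha> b)" and xb: "3 * S + 3 < dist x (\<alpha> b)"
    define e where "e = a - dist x (q a)"
    have e: "e \<le> a" by (simp add: e_def)
    obtain p where p: "quasi_geodesic (3 * k) (c + 1) e b p" "\<And>s. s \<in> {a..b} \<Longrightarrow> p s = q s" "p e = x"
      "\<And>s. s \<in> {e..a} \<Longrightarrow> dist (p s) (q a) \<le> dist x (q a)"
      using quasi_geodesic_prepend[OF geod k c q near] unfolding e_def by blast
    obtain s1 where s1: "s1 \<in> {e..b}" and min: "\<And>s. s \<in> {e..b} \<Longrightarrow> dist (\<alpha> b) (p s1) \<le> dist (\<alpha> b) (p s) + 1"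
      using near_minimum_exists[of "{e..b}" "\<lambda>s. dist (\<alpha> b) (p s)"] e ab by auto
    have close: "dist (\<alpha> b) (p s1) \<le> S + 1"
      using min[of b] p(2)[of b] qb e ab by (simp add: dist_commute)
    \<comment> \<open>The near-minimum lies within \<open>S + 1\<close> of
      \<open>\<alpha> b\<close>. On \<open>q\<close> before time 0 this contradicts
      \<open>far\<close>; on the attached geodesic, whose length is at most \<open>S + 1\<close>, it
      would put \<open>x\<close> within \<open>3 * S + 3\<close> of
      \<open>\<alpha> b\<close>.\<close>
    have "0 \<le> s1"
    proof (rule ccontr)
      assume neg: "\<not> 0 \<le> s1"
      show False
      proof (cases "a \<le> s1")
        case True
        then show False using far[of s1] close p(2)[of s1] neg ab by (simp add: dist_commute)
      next
        case False
        then have "dist (p s1) (q a) \<le> dist x (q a)" using p(4)[of s1] s1 by simp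
        moreover have "dist x (q a) \<le> S + 1" using near[of 0] q0 ab by simp
        moreover have "dist x (\<alpha> b) \<le> dist x (q a) + dist (q a) (p s1) + dist (p s1) (\<alpha> b)"
          using dist_triangle[of x "\<alpha> b" "p s1"] dist_triangle[of x "p s1" "q a"] by linarith
        ultimately show False using close xb by (simp add: dist_commute)
      qed
    qed
    have "quasi_geodesic (3 * k) (c + 1) e s1 p" using quasi_geodesic_subinterval[OF p(1)] s1 by simp
    moreover have "3 * k \<ge> 1" "c + 1 \<ge> 0" using k c by auto
    moreover have "dist (\<alpha> b) (p s1) \<le> dist (\<alpha> b) (p s) + 1" if "s \<in> {e..s1}" for s
      using min[of s] that s1 by simp
    ultimately obtain p' where p': "quasi_geodesic (3 * (3 * k)) (c + 1 + 1) e (s1 + dist (\<alpha> b) (p s1)) p'"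
      "\<And>s. s \<in> {e..s1} \<Longrightarrow> p' s = p s" "p' (s1 + dist (\<alpha> b) (p s1)) = \<alpha> b"
      using quasi_geodesic_append[OF geod, of "3 * k" "c + 1" e s1 p "\<alpha> b"] by metis
    have "p' e = \<alpha> 0" using p'(2)[of e] p(3) s1 x by simp
    moreover have "p' 0 = q 0" using p'(2)[of 0] p(2)[of 0] \<open>0 \<le> s1\<close> e ab by simp
    moreover have "0 \<in> {e..s1 + dist (\<alpha> b) (p s1)}" using \<open>0 \<le> s1\<close> e ab by simp
    ultimately show "\<exists>t\<ge>0. dist (q 0) (\<alpha> t) \<le> C"
      using C[OF p'(1), of 0] p'(3) ab by auto
  qed
qed

section \<open>The quasi-line formed by two rays and its image under a coarsely fixing map\<close>

definition bi_ray :: "(real \<Rightarrow> 'a) \<Rightarrow> (real \<Rightarrow> 'a) \<Rightarrow> real \<Rightarrow> 'a" where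
  "bi_ray \<alpha> \<beta> s = (if 0 \<le> s then \<alpha> s else \<beta> (- s))"

lemma bi_ray_reverse: "\<alpha> 0 = \<beta> 0 \<Longrightarrow> bi_ray \<alpha> \<beta> (- s) = bi_ray \<beta> \<alpha> s"
  by (cases "s = 0") (auto simp: bi_ray_def)

lemma bi_ray_quasi_geodesic:
  assumes \<alpha>: "coarse_morse_ray x D \<alpha>" and \<beta>: "coarse_morse_ray x D \<beta>" and c: "0 \<le> c"
    and lin: "\<And>s t. s \<ge> 0 \<Longrightarrow> t \<ge> 0 \<Longrightarrow> (s + t) / 3 - c \<le> dist (\<alpha> s) (\<beta> t)" and ab: "a \<le> b"
  shows "quasi_geodesic 3 (c + 2 * D) a b (bi_ray \<alpha> \<beta>)"
proof -
  have D: "0 \<le> D" "\<alpha> 0 = x" "\<beta> 0 = x" using \<alpha> \<beta> by (auto simp: coarse_morse_ray_def)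
  have same: "(t - s) / 3 - (c + 2 * D) \<le> d \<and> d \<le> 3 * (t - s) + (c + 2 * D)"
    if "\<bar>d - \<bar>s - t\<bar>\<bar> \<le> D" "s \<le> t" for d s t :: real
  proof -
    have "d \<le> (t - s) + D" "t - s \<le> d + D" using that by (auto simp: abs_le_iff)
    then show ?thesis using that D c by (simp add: field_simps)
  qed
  show ?thesis
  proof (rule quasi_geodesicI_less)
    fix s t assume st: "a \<le> s" "s < t" "t \<le> b"
    consider "0 \<le> s" | "t < 0" | "s < 0" "0 \<le> t" by linarith
    then show "(t - s) / 3 - (c + 2 * D) \<le> dist (bi_ray \<alpha> \<beta> s) (bi_ray \<alpha> \<beta> t) \<and>
        dist (bi_ray \<alpha> \<beta> s) (bi_ray \<alpha> \<beta> t) \<le> 3 * (t - s) + (c + 2 * D)"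
    proof cases
      case 1
      then show ?thesis using same[OF coarse_morse_ray_dist[OF \<alpha>, of s t]] st by (simp add: bi_ray_def)
    next
      case 2
      then show ?thesis using same[of "dist (\<beta> (- s)) (\<beta> (- t))" s t] coarse_morse_ray_dist[OF \<beta>, of "- s" "- t"] st
        by (simp add: bi_ray_def abs_minus_commute)
    next
      case 3
      have "(t - s) / 3 - c \<le> dist (\<alpha> t) (\<beta> (- s))" using lin[of t "- s"] 3 by simp
      moreover have "dist (\<alpha> t) (\<beta> (- s)) \<le> dist (\<alpha> t) x + dist x (\<beta> (- s))" by (rule dist_triangle)
      moreover have "dist (\<alpha> t) x \<le> t + D"
        using coarse_morse_ray_dist[OF \<alpha>, of t 0] 3 D by (simp add: abs_le_iff)
      moreover have "dist x (\<beta> (- s)) \<le> - s + D"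
        using coarse_morse_ray_dist[OF \<beta>, of 0 "- s"] 3 D by (simp add: abs_le_iff)
      ultimately show ?thesis using 3 D c st by (simp add: bi_ray_def dist_commute)
    qed
  qed (use ab c D in auto)
qed

lemma quasi_geodesic_image:
  assumes f: "qi_embedding K A f" and K: "K \<ge> 1" and k: "k \<ge> 1" and c: "c \<ge> 0" and q: "quasi_geodesic k c a b q"
  shows "quasi_geodesic (k * K) (K * c + A) a b (\<lambda>s. f (q s))"
  unfolding quasi_geodesic_def
proof (intro conjI ballI)
  show "a \<le> b" using q by (simp add: quasi_geodesic_def)
  fix s t assume st: "s \<in> {a..b}" "t \<in> {a..b}"
  note Q = quasi_geodesicD[OF q st]
  have F: "dist (q s) (q t) / K - A \<le> dist (f (q s)) (f (q t))"
    "dist (f (q s)) (f (q t)) \<le> K * dist (q s) (q t) + A" using f by (auto simp: qi_embedding_def)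
  have "K * dist (q s) (q t) \<le> K * (k * \<bar>s - t\<bar> + c)" using Q K by (intro mult_left_mono) auto
  then show "dist (f (q s)) (f (q t)) \<le> k * K * \<bar>s - t\<bar> + (K * c + A)" using F by (simp add: algebra_simps)
  have "(\<bar>s - t\<bar> / k - c) / K \<le> dist (q s) (q t) / K" using Q K by (intro divide_right_mono) auto
  moreover have "c / K \<le> c" using K c by (simp add: divide_le_eq mult_le_cancel_left1)
  moreover have "c \<le> K * c" using mult_right_mono[OF K c] by simp
  ultimately show "\<bar>s - t\<bar> / (k * K) - (K * c + A) \<le> dist (f (q s)) (f (q t))"
    using F by (simp add: diff_divide_distrib)
qed

text \<open>\<open>B\<close> comes from \<open>quasi_geodesic_captured\<close> for the image of the
  quasi-line, whose constants involve only \<open>K\<close>, \<open>A\<close> and the rays. The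
  image is cut at a parameter \<open>s0\<close> in \<open>{-M..M}\<close> nearly closest to
  \<open>x\<close>. If \<open>s0 \<le> 0\<close>, the part from \<open>s0\<close> to
  \<open>M\<close> still passes through \<open>f x\<close> and ends near \<open>\<alpha> M\<close>;
  otherwise the reversed line does the same with \<open>\<beta>\<close>.\<close>

lemma coarsely_fixed_near_bi_ray:
  fixes \<alpha> \<beta> :: "real \<Rightarrow> 'a::metric_space"
  assumes geod: "geodesic_space TYPE('a)" and \<alpha>: "coarse_morse_ray x D \<alpha>" and \<beta>: "coarse_morse_ray x D \<beta>"
    and div: "diverging \<alpha> \<beta>" and K: "K \<ge> 1" and A: "A \<ge> 0"
  shows "\<exists>B. \<forall>S. \<exists>R. \<forall>f. qi_embedding K A f \<longrightarrow> (\<forall>z\<in>cball x R. dist (f z) z \<le> S) \<longrightarrow>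
    (\<exists>t\<ge>0. dist (f x) (\<alpha> t) \<le> B \<or> dist (f x) (\<beta> t) \<le> B)"
proof -
  have D: "0 \<le> D" "\<alpha> 0 = x" "\<beta> 0 = x" using \<alpha> \<beta> by (auto simp: coarse_morse_ray_def)
  obtain c where c: "c \<ge> 0" and lin: "\<And>s t. s \<ge> 0 \<Longrightarrow> t \<ge> 0 \<Longrightarrow> (s + t) / 3 - c \<le> dist (\<alpha> s) (\<beta> t)"
    using diverging_linear[OF geod \<alpha> \<beta> div] by blast
  have lin': "(s + t) / 3 - c \<le> dist (\<beta> s) (\<alpha> t)" if "s \<ge> 0" "t \<ge> 0" for s t
    using lin[of t s] that by (simp add: dist_commute add.commute)
  define k c' where "k = 3 * K" and "c' = K * (c + 2 * D) + A"
  have kc: "k \<ge> 1" "c' \<ge> 0" using K A c D by (auto simp: k_def c'_def)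
  txt \<open>The two ends of the quasi-line are treated alike, hence the roles of the rays are left open.\<close>
  have half: "\<exists>B. \<forall>S M s0 f. qi_embedding K A f \<longrightarrow> (\<forall>z\<in>cball x (M + D). dist (f z) z \<le> S) \<longrightarrow>
      3 * (c + 2 * S + 1) < M \<longrightarrow> D + 3 * S + 3 < M \<longrightarrow> 0 \<le> S \<longrightarrow> s0 \<in> {-M..0} \<longrightarrow>
      (\<forall>s\<in>{-M..M}. dist x (f (bi_ray \<mu> \<nu> s0)) \<le> dist x (f (bi_ray \<mu> \<nu> s)) + 1) \<longrightarrow>
      (\<exists>t\<ge>0. dist (f x) (\<mu> t) \<le> B)"
    if \<mu>: "coarse_morse_ray x D \<mu>" and \<nu>: "coarse_morse_ray x D \<nu>"
      and l: "\<And>s t. s \<ge> 0 \<Longrightarrow> t \<ge> 0 \<Longrightarrow> (s + t) / 3 - c \<le> dist (\<mu> s) (\<nu> t)" for \<mu> \<nu> :: "real \<Rightarrow> 'a"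
  proof -
    have x: "\<mu> 0 = x" "\<nu> 0 = x" using \<mu> \<nu> by (auto simp: coarse_morse_ray_def)
    obtain B where B: "\<And>S a b q. \<lbrakk>quasi_geodesic k c' a b q; a \<le> 0; 0 \<le> b;
      \<And>s. s \<in> {a..b} \<Longrightarrow> dist x (q a) \<le> dist x (q s) + 1; dist x (q 0) \<le> S; dist (q b) (\<mu> b) \<le> S;
      \<And>s. s \<in> {a..0} \<Longrightarrow> S + 1 < dist (q s) (\<mu> b); 3 * S + 3 < dist x (\<mu> b)\<rbrakk>
      \<Longrightarrow> \<exists>t\<ge>0. dist (q 0) (\<mu> t) \<le> B"
      using quasi_geodesic_captured[OF geod \<mu> kc] by blast
    show ?thesis
    proof (rule exI[of _ B], intro allI impI)
      fix S M s0 f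
      assume f: "qi_embedding K A f" and fS: "\<forall>z\<in>cball x (M + D). dist (f z) z \<le> S"
        and M1: "3 * (c + 2 * S + 1) < M" and M2: "D + 3 * S + 3 < M" and S: "0 \<le> S" and s0: "s0 \<in> {-M..0}"
        and near: "\<forall>s\<in>{-M..M}. dist x (f (bi_ray \<mu> \<nu> s0)) \<le> dist x (f (bi_ray \<mu> \<nu> s)) + 1"
      have M: "0 \<le> M" using M2 D S by simp
      have x\<mu>: "\<bar>dist x (\<mu> t) - t\<bar> \<le> D" if "0 \<le> t" for t using coarse_morse_ray_dist[OF \<mu>, of 0 t] that x by simp
      have x\<nu>: "\<bar>dist x (\<nu> t) - t\<bar> \<le> D" if "0 \<le> t" for t using coarse_morse_ray_dist[OF \<nu>, of 0 t] that x by simp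
      \<comment> \<open>A point of a ray at time at most \<open>M\<close> lies within
        \<open>M + D\<close> of \<open>x\<close>, the radius on which \<open>f\<close> is
        controlled.\<close>
      have f\<mu>: "dist (f (\<mu> t)) (\<mu> t) \<le> S" if "0 \<le> t" "t \<le> M" for t
        using fS x\<mu>[of t] that by (simp add: abs_le_iff)
      have f\<nu>: "dist (f (\<nu> t)) (\<nu> t) \<le> S" if "0 \<le> t" "t \<le> M" for t
        using fS x\<nu>[of t] that by (simp add: abs_le_iff)
      define q where "q s = f (bi_ray \<mu> \<nu> s)" for s
      have "quasi_geodesic 3 (c + 2 * D) s0 M (bi_ray \<mu> \<nu>)"
        using bi_ray_quasi_geodesic[OF \<mu> \<nu> c l, of s0 M] s0 M by auto
      then have "quasi_geodesic k c' s0 M q"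
        unfolding k_def c'_def q_def using quasi_geodesic_image[OF f K] c D by auto
      moreover have "dist x (q s0) \<le> dist x (q s) + 1" if "s \<in> {s0..M}" for s
        using near that s0 by (auto simp: q_def)
      moreover have q0: "q 0 = f x" by (simp add: q_def bi_ray_def x)
      have "dist x (q 0) \<le> S" using f\<mu>[of 0] M x by (simp add: q0 dist_commute)
      moreover have "dist (q M) (\<mu> M) \<le> S" using f\<mu>[of M] M by (simp add: q_def bi_ray_def)
      moreover have "S + 1 < dist (q s) (\<mu> M)" if s: "s \<in> {s0..0}" for s
      proof -
        have "q s = f (\<nu> (- s))" using s x by (cases "s = 0") (auto simp: q_def bi_ray_def)
        then have "dist (q s) (\<nu> (- s)) \<le> S" using f\<nu>[of "- s"] s s0 by simp
        moreover have "(M + - s) / 3 - c \<le> dist (\<mu> M) (\<nu> (- s))" using l[of M "- s"] M s by simp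
        moreover have "dist (\<mu> M) (\<nu> (- s)) \<le> dist (q s) (\<mu> M) + dist (q s) (\<nu> (- s))"
          by (metis dist_commute dist_triangle)
        moreover have "M / 3 \<le> (M + - s) / 3" using s by simp
        \<comment> \<open>One \<open>S\<close> is lost in replacing \<open>q s\<close> by
          \<open>\<nu> (- s)\<close>; what remains exceeds \<open>S + 1\<close>.\<close>
        moreover have "c + 2 * S + 1 < M / 3" using M1 by simp
        ultimately show ?thesis by linarith
      qed
      moreover have "3 * S + 3 < dist x (\<mu> M)" using x\<mu>[of M] M M2 by (simp add: abs_le_iff)
      ultimately show "\<exists>t\<ge>0. dist (f x) (\<mu> t) \<le> B" using B[of s0 M q S] s0 M q0 by simp
    qed
  qed
  from half[OF \<alpha> \<beta> lin] obtain B1 where B1: "\<And>S M s0 f. qi_embedding K A f \<Longrightarrow> (\<forall>z\<in>cball x (M + D). dist (f z) z \<le> S) \<Longrightarrow>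
      3 * (c + 2 * S + 1) < M \<Longrightarrow> D + 3 * S + 3 < M \<Longrightarrow> 0 \<le> S \<Longrightarrow> s0 \<in> {-M..0} \<Longrightarrow>
      (\<forall>s\<in>{-M..M}. dist x (f (bi_ray \<alpha> \<beta> s0)) \<le> dist x (f (bi_ray \<alpha> \<beta> s)) + 1) \<Longrightarrow>
      (\<exists>t\<ge>0. dist (f x) (\<alpha> t) \<le> B1)" by blast
  from half[OF \<beta> \<alpha> lin'] obtain B2 where B2: "\<And>S M s0 f. qi_embedding K A f \<Longrightarrow> (\<forall>z\<in>cball x (M + D). dist (f z) z \<le> S) \<Longrightarrow>
      3 * (c + 2 * S + 1) < M \<Longrightarrow> D + 3 * S + 3 < M \<Longrightarrow> 0 \<le> S \<Longrightarrow> s0 \<in> {-M..0} \<Longrightarrow>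
      (\<forall>s\<in>{-M..M}. dist x (f (bi_ray \<beta> \<alpha> s0)) \<le> dist x (f (bi_ray \<beta> \<alpha> s)) + 1) \<Longrightarrow>
      (\<exists>t\<ge>0. dist (f x) (\<beta> t) \<le> B2)" by blast
  have "\<exists>R. \<forall>f. qi_embedding K A f \<longrightarrow> (\<forall>z\<in>cball x R. dist (f z) z \<le> S) \<longrightarrow>
    (\<exists>t\<ge>0. dist (f x) (\<alpha> t) \<le> max B1 B2 \<or> dist (f x) (\<beta> t) \<le> max B1 B2)" for S
  proof -
    \<comment> \<open>Exceeds both thresholds of \<open>half\<close>; the absolute value covers
      negative \<open>S\<close>, as \<open>half\<close> asks for a nonnegative one.\<close>
    define M where "M = 3 * (c + 2 * \<bar>S\<bar> + 1) + D + 3 * \<bar>S\<bar> + 4"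
    have M: "3 * (c + 2 * \<bar>S\<bar> + 1) < M" "D + 3 * \<bar>S\<bar> + 3 < M" "0 \<le> M" using D c by (simp_all add: M_def)
    show ?thesis
    proof (rule exI[of _ "M + D"], intro allI impI)
      fix f assume f: "qi_embedding K A f" and fS: "\<forall>z\<in>cball x (M + D). dist (f z) z \<le> S"
      have fS': "\<forall>z\<in>cball x (M + D). dist (f z) z \<le> \<bar>S\<bar>" using fS by fastforce
      obtain s0 where s0: "s0 \<in> {-M..M}"
        and near: "\<And>s. s \<in> {-M..M} \<Longrightarrow> dist x (f (bi_ray \<alpha> \<beta> s0)) \<le> dist x (f (bi_ray \<alpha> \<beta> s)) + 1"
        using near_minimum_exists[of "{-M..M}" "\<lambda>s. dist x (f (bi_ray \<alpha> \<beta> s))"] M by auto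
      show "\<exists>t\<ge>0. dist (f x) (\<alpha> t) \<le> max B1 B2 \<or> dist (f x) (\<beta> t) \<le> max B1 B2"
      proof (cases "s0 \<le> 0")
        case True
        then obtain t where "t \<ge> 0" "dist (f x) (\<alpha> t) \<le> B1" using B1[OF f fS' M(1,2), of s0] s0 near by auto
        then show ?thesis by (intro exI[of _ t]) auto
      next
        case False
        have rev: "bi_ray \<beta> \<alpha> s = bi_ray \<alpha> \<beta> (- s)" for s using bi_ray_reverse[of \<alpha> \<beta> s] D by simp
        have "\<forall>s\<in>{-M..M}. dist x (f (bi_ray \<beta> \<alpha> (- s0))) \<le> dist x (f (bi_ray \<beta> \<alpha> s)) + 1"
          using near by (simp add: rev)
        then obtain t where "t \<ge> 0" "dist (f x) (\<beta> t) \<le> B2" using B2[OF f fS' M(1,2), of "- s0"] s0 False by auto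
        then show ?thesis by (intro exI[of _ t]) auto
      qed
    qed
  qed
  then show ?thesis by blast
qed

lemma coarse_morse_ray_mono:
  assumes "coarse_morse_ray x D \<alpha>" "D \<le> D'"
  shows "coarse_morse_ray x D' \<alpha>"
proof -
  have "quasi_geodesic 1 D' 0 b \<alpha>" if "quasi_geodesic 1 D 0 b \<alpha>" for b
    using that assms(2) unfolding quasi_geodesic_def by force
  then show ?thesis using assms unfolding coarse_morse_ray_def by auto
qed

lemma coarsely_fixed_tripod_centre:
  fixes \<alpha> \<beta> \<gamma> :: "real \<Rightarrow> 'a::metric_space"
  assumes geod: "geodesic_space TYPE('a)"
    and rays: "coarse_morse_ray x D \<alpha>" "coarse_morse_ray x D \<beta>" "coarse_morse_ray x D \<gamma>"
    and div: "diverging \<alpha> \<beta>" "diverging \<alpha> \<gamma>" "diverging \<beta> \<gamma>" and K: "K \<ge> 1" and A: "A \<ge> 0"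
  shows "\<exists>B. \<forall>S. \<exists>R. \<forall>f. qi_embedding K A f \<longrightarrow> (\<forall>z\<in>cball x R. dist (f z) z \<le> S) \<longrightarrow> dist (f x) x \<le> B"
proof -
  note near = coarsely_fixed_near_bi_ray[OF geod _ _ _ K A, of x D]
  obtain B1 where B1: "\<And>S. \<exists>R. \<forall>f. qi_embedding K A f \<longrightarrow> (\<forall>z\<in>cball x R. dist (f z) z \<le> S) \<longrightarrow>
    (\<exists>t\<ge>0. dist (f x) (\<alpha> t) \<le> B1 \<or> dist (f x) (\<beta> t) \<le> B1)" using near[OF rays(1,2) div(1)] by blast
  obtain B2 where B2: "\<And>S. \<exists>R. \<forall>f. qi_embedding K A f \<longrightarrow> (\<forall>z\<in>cball x R. dist (f z) z \<le> S) \<longrightarrow>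
    (\<exists>t\<ge>0. dist (f x) (\<alpha> t) \<le> B2 \<or> dist (f x) (\<gamma> t) \<le> B2)" using near[OF rays(1,3) div(2)] by blast
  obtain B3 where B3: "\<And>S. \<exists>R. \<forall>f. qi_embedding K A f \<longrightarrow> (\<forall>z\<in>cball x R. dist (f z) z \<le> S) \<longrightarrow>
    (\<exists>t\<ge>0. dist (f x) (\<beta> t) \<le> B3 \<or> dist (f x) (\<gamma> t) \<le> B3)" using near[OF rays(2,3) div(3)] by blast
  define B where "B = max B1 (max B2 B3)"
  have B: "B1 \<le> B" "B2 \<le> B" "B3 \<le> B" by (auto simp: B_def)
  \<comment> \<open>Two points within \<open>B\<close> of \<open>y\<close> are at most
    \<open>2 * B\<close> apart, so divergence bounds \<open>s\<close>, and \<open>s\<close> is the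
    distance from \<open>\<mu> s\<close> to \<open>x\<close> up to \<open>D\<close>.\<close>
  have two: "\<exists>M. \<forall>y s t. s \<ge> 0 \<longrightarrow> t \<ge> 0 \<longrightarrow> dist y (\<mu> s) \<le> B \<longrightarrow> dist y (\<nu> t) \<le> B \<longrightarrow> dist y x \<le> M"
    if \<mu>: "coarse_morse_ray x D \<mu>" and d: "diverging \<mu> \<nu>" for \<mu> \<nu>
  proof -
    obtain M where M: "\<And>s t. s \<ge> 0 \<Longrightarrow> t \<ge> 0 \<Longrightarrow> dist (\<mu> s) (\<nu> t) \<le> 2 * B \<Longrightarrow> s \<le> M"
      using d unfolding diverging_def by meson
    have "dist y x \<le> B + M + D" if st: "s \<ge> 0" "t \<ge> 0" and y: "dist y (\<mu> s) \<le> B" "dist y (\<nu> t) \<le> B" for y s t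
    proof -
      have "dist (\<mu> s) (\<nu> t) \<le> 2 * B" using y dist_triangle[of "\<mu> s" "\<nu> t" y] by (simp add: dist_commute)
      then have "s \<le> M" using M st by blast
      moreover have "dist (\<mu> s) x \<le> s + D"
        using coarse_morse_ray_dist[OF \<mu> st(1), of 0] \<mu> st by (simp add: abs_le_iff coarse_morse_ray_def)
      ultimately show ?thesis using y dist_triangle[of y x "\<mu> s"] by linarith
    qed
    then show ?thesis by blast
  qed
  obtain M1 where M1: "\<And>y s t. s \<ge> 0 \<Longrightarrow> t \<ge> 0 \<Longrightarrow> dist y (\<alpha> s) \<le> B \<Longrightarrow> dist y (\<beta> t) \<le> B \<Longrightarrow> dist y x \<le> M1"
    using two[OF rays(1) div(1)] by blast
  obtain M2 where M2: "\<And>y s t. s \<ge> 0 \<Longrightarrow> t \<ge> 0 \<Longrightarrow> dist y (\<alpha> s) \<le> B \<Longrightarrow> dist y (\<gamma> t) \<le> B \<Longrightarrow> dist y x \<le> M2"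
    using two[OF rays(1) div(2)] by blast
  obtain M3 where M3: "\<And>y s t. s \<ge> 0 \<Longrightarrow> t \<ge> 0 \<Longrightarrow> dist y (\<beta> s) \<le> B \<Longrightarrow> dist y (\<gamma> t) \<le> B \<Longrightarrow> dist y x \<le> M3"
    using two[OF rays(2) div(3)] by blast
  define M where "M = max M1 (max M2 M3)"
  have "\<exists>R. \<forall>f. qi_embedding K A f \<longrightarrow> (\<forall>z\<in>cball x R. dist (f z) z \<le> S) \<longrightarrow> dist (f x) x \<le> M" for S
  proof -
    obtain R1 where R1: "\<And>f. qi_embedding K A f \<Longrightarrow> (\<forall>z\<in>cball x R1. dist (f z) z \<le> S) \<Longrightarrow>
      (\<exists>t\<ge>0. dist (f x) (\<alpha> t) \<le> B1 \<or> dist (f x) (\<beta> t) \<le> B1)" using B1 by blast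
    obtain R2 where R2: "\<And>f. qi_embedding K A f \<Longrightarrow> (\<forall>z\<in>cball x R2. dist (f z) z \<le> S) \<Longrightarrow>
      (\<exists>t\<ge>0. dist (f x) (\<alpha> t) \<le> B2 \<or> dist (f x) (\<gamma> t) \<le> B2)" using B2 by blast
    obtain R3 where R3: "\<And>f. qi_embedding K A f \<Longrightarrow> (\<forall>z\<in>cball x R3. dist (f z) z \<le> S) \<Longrightarrow>
      (\<exists>t\<ge>0. dist (f x) (\<beta> t) \<le> B3 \<or> dist (f x) (\<gamma> t) \<le> B3)" using B3 by blast
    define R where "R = max R1 (max R2 R3)"
    show ?thesis
    proof (rule exI[of _ R], intro allI impI)
      fix f assume f: "qi_embedding K A f" and fS: "\<forall>z\<in>cball x R. dist (f z) z \<le> S"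
      have fS': "\<forall>z\<in>cball x R1. dist (f z) z \<le> S" "\<forall>z\<in>cball x R2. dist (f z) z \<le> S"
        "\<forall>z\<in>cball x R3. dist (f z) z \<le> S" using fS by (auto simp: R_def)
      define near where "near \<mu> \<longleftrightarrow> (\<exists>t\<ge>0. dist (f x) (\<mu> t) \<le> B)" for \<mu> :: "real \<Rightarrow> 'a"
      have "near \<alpha> \<or> near \<beta>" "near \<alpha> \<or> near \<gamma>" "near \<beta> \<or> near \<gamma>"
        using R1[OF f fS'(1)] R2[OF f fS'(2)] R3[OF f fS'(3)] B order_trans[of _ _ B] unfolding near_def by blast+
      \<comment> \<open>Each ray is missing from one of the three disjunctions, so at least two rays
        are near \<open>f x\<close>.\<close>
      then consider "near \<alpha>" "near \<beta>" | "near \<alpha>" "near \<gamma>" | "near \<beta>" "near \<gamma>" by blast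
      then have "dist (f x) x \<le> M1 \<or> dist (f x) x \<le> M2 \<or> dist (f x) x \<le> M3"
        by cases (use M1 M2 M3 in \<open>auto simp: near_def\<close>)
      then show "dist (f x) x \<le> M" by (auto simp: M_def)
    qed
  qed
  then show ?thesis by blast
qed

section \<open>Points of the Morse boundary and tameness at every point\<close>

lemma finite_hausdorff_refl: "finite_hausdorff \<gamma> \<gamma>"
  unfolding finite_hausdorff_def by (intro exI[of _ 0]) (metis dist_self order.refl)

lemma finite_hausdorff_sym: "finite_hausdorff \<gamma> \<delta> \<Longrightarrow> finite_hausdorff \<delta> \<gamma>"
  unfolding finite_hausdorff_def by blast

lemma finite_hausdorff_trans:
  assumes "finite_hausdorff \<gamma> \<delta>" "finite_hausdorff \<delta> \<epsilon>"
  shows "finite_hausdorff \<gamma> \<epsilon>"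
proof -
  obtain C C' where
    C: "\<And>s. s \<ge> 0 \<Longrightarrow> \<exists>t\<ge>0. dist (\<gamma> s) (\<delta> t) \<le> C" "\<And>s. s \<ge> 0 \<Longrightarrow> \<exists>t\<ge>0. dist (\<delta> s) (\<gamma> t) \<le> C" and
    C': "\<And>s. s \<ge> 0 \<Longrightarrow> \<exists>t\<ge>0. dist (\<delta> s) (\<epsilon> t) \<le> C'" "\<And>s. s \<ge> 0 \<Longrightarrow> \<exists>t\<ge>0. dist (\<epsilon> s) (\<delta> t) \<le> C'"
    using assms unfolding finite_hausdorff_def by blast
  have "\<exists>t\<ge>0. dist (\<gamma> s) (\<epsilon> t) \<le> C + C'" if s: "s \<ge> 0" for s
  proof -
    obtain u where u: "u \<ge> 0" "dist (\<gamma> s) (\<delta> u) \<le> C" using C(1) s by blast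
    obtain t where t: "t \<ge> 0" "dist (\<delta> u) (\<epsilon> t) \<le> C'" using C'(1) u by blast
    then show ?thesis using u dist_triangle[of "\<gamma> s" "\<epsilon> t" "\<delta> u"] by (intro exI[of _ t]) simp
  qed
  moreover have "\<exists>t\<ge>0. dist (\<epsilon> s) (\<gamma> t) \<le> C + C'" if s: "s \<ge> 0" for s
  proof -
    obtain u where u: "u \<ge> 0" "dist (\<epsilon> s) (\<delta> u) \<le> C'" using C'(2) s by blast
    obtain t where t: "t \<ge> 0" "dist (\<delta> u) (\<gamma> t) \<le> C" using C(2) u by blast
    then show ?thesis using u dist_triangle[of "\<epsilon> s" "\<gamma> t" "\<delta> u"] by (intro exI[of _ t]) simp
  qed
  ultimately show ?thesis unfolding finite_hausdorff_def by blast
qed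

lemma equiv_morse_rel: "equiv {\<gamma>. morse_ray \<gamma>} morse_rel"
proof (rule equivI)
  show "refl_on {\<gamma>. morse_ray \<gamma>} morse_rel"
    by (rule refl_onI) (auto simp: morse_rel_def finite_hausdorff_refl)
  show "sym morse_rel"
    by (rule symI) (auto simp: morse_rel_def intro: finite_hausdorff_sym)
  show "trans morse_rel"
    by (rule transI) (auto simp: morse_rel_def intro: finite_hausdorff_trans)
qed (auto simp: morse_rel_def)

lemma morse_boundary_distinct_diverging:
  assumes p: "p \<in> morse_boundary TYPE('a::metric_space)" and q: "q \<in> morse_boundary TYPE('a)"
    and "p \<noteq> q" and "\<alpha> \<in> p" "\<beta> \<in> q"
  shows "morse_ray \<alpha>" "morse_ray \<beta>" "diverging \<alpha> \<beta>"
proof -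
  show m: "morse_ray \<alpha>" "morse_ray \<beta>"
    using in_quotient_imp_subset[OF equiv_morse_rel, of p] in_quotient_imp_subset[OF equiv_morse_rel, of q] assms
    unfolding morse_boundary_def by blast+
  have "(\<alpha>, \<beta>) \<notin> morse_rel"
    using quotient_eqI[OF equiv_morse_rel, of p q \<alpha> \<beta>] assms unfolding morse_boundary_def by blast
  then show "diverging \<alpha> \<beta>" using m morse_rays_diverging by (auto simp: morse_rel_def)
qed

text \<open>Tameness is known at one point \<open>x\<close>. An isometry \<open>h\<close> carries
  \<open>x\<close> to within \<open>E\<close> of \<open>y\<close>, and conjugating \<open>f\<close>
  by it preserves \<open>K\<close> and \<open>A\<close>. Passing between \<open>y\<close> and
  \<open>h x\<close> enlarges the radius by \<open>E\<close> and costs \<open>K * E + A + E\<close>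
  in displacement, none of which involves \<open>S\<close>.\<close>

lemma locally_tame:
  fixes K A :: real
  assumes geod: "geodesic_space TYPE('a::metric_space)" and coc: "cocompact TYPE('a)"
    and bd: "\<exists>p\<in>morse_boundary TYPE('a). \<exists>q\<in>morse_boundary TYPE('a). \<exists>r\<in>morse_boundary TYPE('a).
           p \<noteq> q \<and> p \<noteq> r \<and> q \<noteq> r" and K: "K \<ge> 1" and A: "A \<ge> 0"
  shows "\<exists>B. \<forall>S. \<exists>R. \<forall>f (y::'a). qi_embedding K A f \<longrightarrow> (\<forall>z\<in>cball y R. dist (f z) z \<le> S) \<longrightarrow> dist (f y) y \<le> B"
proof -
  obtain K0 :: "'a set" where K0: "compact K0" "(\<Union>f\<in>{f. isometry f}. f ` K0) = UNIV"
    using coc unfolding cocompact_def by blast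
  then obtain x where x: "x \<in> K0" by blast
  obtain E where E: "\<And>y. y \<in> K0 \<Longrightarrow> dist x y \<le> E"
    using compact_imp_bounded[OF K0(1)] by (auto simp: bounded_any_center[of _ x])
  have dense: "\<exists>h. isometry h \<and> dist (h x) y \<le> E" for y
  proof -
    have "y \<in> (\<Union>f\<in>{f. isometry f}. f ` K0)" using K0(2) by simp
    then obtain h k where "isometry h" "k \<in> K0" "y = h k" by blast
    then show ?thesis using E[of k] by (auto simp: isometry_def)
  qed
  obtain p q r where pqr: "p \<in> morse_boundary TYPE('a)" "q \<in> morse_boundary TYPE('a)"
    "r \<in> morse_boundary TYPE('a)" "p \<noteq> q" "p \<noteq> r" "q \<noteq> r" using bd by blast
  have "p \<noteq> {}" "q \<noteq> {}" "r \<noteq> {}"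
    using pqr(1-3) in_quotient_imp_non_empty[OF equiv_morse_rel] unfolding morse_boundary_def by blast+
  then obtain \<alpha> \<beta> \<gamma> where abc: "\<alpha> \<in> p" "\<beta> \<in> q" "\<gamma> \<in> r" by blast
  note rays = morse_boundary_distinct_diverging[OF pqr(1,2,4) abc(1,2)]
    morse_boundary_distinct_diverging[OF pqr(1,3,5) abc(1,3)]
    morse_boundary_distinct_diverging[OF pqr(2,3,6) abc(2,3)]
  define D where "D = max (2 * dist x (\<alpha> 0)) (max (2 * dist x (\<beta> 0)) (2 * dist x (\<gamma> 0)))"
  define base where "base \<mu> = (\<lambda>t::real. if t = 0 then x else \<mu> t)" for \<mu>
  have coarse: "coarse_morse_ray x D (base \<alpha>)" "coarse_morse_ray x D (base \<beta>)" "coarse_morse_ray x D (base \<gamma>)"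
    unfolding base_def using rays
    by (auto intro!: coarse_morse_ray_mono[OF coarse_morse_ray_rebase] simp: D_def)
  have div: "diverging (base \<alpha>) (base \<beta>)" "diverging (base \<alpha>) (base \<gamma>)" "diverging (base \<beta>) (base \<gamma>)"
    unfolding base_def using rays by (auto intro!: diverging_rebase)
  obtain B where B: "\<And>S. \<exists>R. \<forall>f. qi_embedding K A f \<longrightarrow> (\<forall>z\<in>cball x R. dist (f z) z \<le> S) \<longrightarrow> dist (f x) x \<le> B"
    using coarsely_fixed_tripod_centre[OF geod coarse div K A] by blast
  have "\<exists>R. \<forall>f (y::'a). qi_embedding K A f \<longrightarrow> (\<forall>z\<in>cball y R. dist (f z) z \<le> S) \<longrightarrow> dist (f y) y \<le> K * E + A + B + E" for S
  proof -
    obtain R where R: "\<And>f. qi_embedding K A f \<Longrightarrow> (\<forall>z\<in>cball x R. dist (f z) z \<le> S) \<Longrightarrow> dist (f x) x \<le> B"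
      using B by blast
    show ?thesis
    proof (rule exI[of _ "R + E"], intro allI impI)
      fix f and y :: 'a assume f: "qi_embedding K A f" and fS: "\<forall>z\<in>cball y (R + E). dist (f z) z \<le> S"
      obtain h where h: "isometry h" and hy: "dist (h x) y \<le> E" using dense by blast
      have hd: "dist (h u) (h v) = dist u v" for u v using h by (simp add: isometry_def)
      have hinv: "h (inv_into UNIV h u) = u" for u using h by (simp add: isometry_def bij_is_surj surj_f_inv_f)
      define g where "g u = inv_into UNIV h (f (h u))" for u
      have hg: "h (g u) = f (h u)" for u by (simp add: g_def hinv)
      have "qi_embedding K A g"
        using f unfolding qi_embedding_def by (metis hd hg)
      moreover have "dist (g z) z \<le> S" if "z \<in> cball x R" for z
      proof -
        have "dist y (h z) \<le> R + E"
          using that hy hd[of x z] dist_triangle[of y "h z" "h x"] by (simp add: dist_commute)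
        then have "dist (f (h z)) (h z) \<le> S" using fS by simp
        then show ?thesis by (metis hd hg)
      qed
      ultimately have "dist (g x) x \<le> B" using R by blast
      then have "dist (f (h x)) (h x) \<le> B" by (metis hd hg)
      moreover have "dist (f y) (f (h x)) \<le> K * dist y (h x) + A" using f by (auto simp: qi_embedding_def)
      moreover have "K * dist y (h x) \<le> K * E" using hy K by (intro mult_left_mono) (auto simp: dist_commute)
      ultimately show "dist (f y) y \<le> K * E + A + B + E"
        using hy dist_triangle[of "f y" y "f (h x)"] dist_triangle[of "f (h x)" y "h x"] by linarith
    qed
  qed
  then show ?thesis by blast
qed

section \<open>Group topologies from neighbourhoods of the identity\<close>

text \<open>The usual axioms for a neighbourhood basis at the identity, with a countable decreasing
  basis. The sets need be neither open nor subgroups; \<open>U_mult\<close> makes each product cost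
  one index.\<close>

locale group_nbhd = group G for G (structure) +
  fixes U :: "nat \<Rightarrow> 'a set"
  assumes U_carrier: "U n \<subseteq> carrier G"
    and one_U: "\<one> \<in> U n"
    and U_Suc: "U (Suc n) \<subseteq> U n"
    and U_inv: "g \<in> U n \<Longrightarrow> inv g \<in> U n"
    and U_mult: "g \<in> U (Suc n) \<Longrightarrow> h \<in> U (Suc n) \<Longrightarrow> g \<otimes> h \<in> U n"
    and U_conj: "g \<in> carrier G \<Longrightarrow> \<exists>m. \<forall>u\<in>U m. g \<otimes> u \<otimes> inv g \<in> U n"
begin

lemma U_antimono: "m \<le> n \<Longrightarrow> U n \<subseteq> U m"
  by (rule lift_Suc_antimono_le[of U]) (rule U_Suc)

text \<open>The entourages of the left uniformity: \<open>h\<close> lies in the left coset of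
  \<open>U n\<close> at \<open>g\<close>. Left translation preserves them; right translation and
  inversion involve a conjugation, which changes the index.\<close>

definition near :: "nat \<Rightarrow> 'a \<Rightarrow> 'a \<Rightarrow> bool" where
  "near n g h \<longleftrightarrow> inv g \<otimes> h \<in> U n"

lemma near_refl: "g \<in> carrier G \<Longrightarrow> near n g g"
  by (simp add: near_def one_U)

lemma near_antimono: "near n g h \<Longrightarrow> m \<le> n \<Longrightarrow> near m g h"
  using U_antimono by (auto simp: near_def)

lemma near_sym: "near n g h \<Longrightarrow> g \<in> carrier G \<Longrightarrow> h \<in> carrier G \<Longrightarrow> near n h g"
  using U_inv[of "inv g \<otimes> h" n] by (simp add: near_def inv_mult_group)

lemma near_trans:
  assumes "near (Suc n) g h" "near (Suc n) h k" "g \<in> carrier G" "h \<in> carrier G" "k \<in> carrier G"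
  shows "near n g k"
proof -
  have "(inv g \<otimes> h) \<otimes> (inv h \<otimes> k) = inv g \<otimes> k"
    using assms(3-5) by (simp add: m_assoc) (simp add: m_assoc[symmetric])
  then show ?thesis using U_mult[of "inv g \<otimes> h" n "inv h \<otimes> k"] assms(1,2) by (simp add: near_def)
qed

lemma near_mult_left:
  assumes "a \<in> carrier G" "g \<in> carrier G" "h \<in> carrier G"
  shows "near n (a \<otimes> g) (a \<otimes> h) \<longleftrightarrow> near n g h"
proof -
  have "inv (a \<otimes> g) \<otimes> (a \<otimes> h) = inv g \<otimes> h"
    using assms by (simp add: inv_mult_group m_assoc) (simp add: m_assoc[symmetric])
  then show ?thesis by (simp add: near_def)
qed

text \<open>Right translation by \<open>a\<close> conjugates \<open>inv g \<otimes> h\<close> by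
  \<open>inv a\<close>. The double inverse stays in the hypothesis so that \<open>U_conj\<close> at
  \<open>inv a\<close> fits verbatim.\<close>

lemma near_mult_right:
  assumes conj: "\<forall>u\<in>U m. inv a \<otimes> u \<otimes> inv (inv a) \<in> U n" and "near m g h"
    and "a \<in> carrier G" "g \<in> carrier G" "h \<in> carrier G"
  shows "near n (g \<otimes> a) (h \<otimes> a)"
proof -
  have "inv a \<otimes> (inv g \<otimes> h) \<otimes> inv (inv a) \<in> U n" using assms by (auto simp: near_def)
  moreover have "inv a \<otimes> (inv g \<otimes> h) \<otimes> inv (inv a) = inv (g \<otimes> a) \<otimes> (h \<otimes> a)"
    using assms(3-5) by (simp add: inv_mult_group m_assoc)
  ultimately show ?thesis by (simp add: near_def)
qed

lemma near_inv:
  assumes conj: "\<forall>u\<in>U m. g \<otimes> u \<otimes> inv g \<in> U n" and "near m g h" and "g \<in> carrier G" "h \<in> carrier G"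
  shows "near n (inv g) (inv h)"
proof -
  have "g \<otimes> (inv h \<otimes> g) \<otimes> inv g \<in> U n" using conj near_sym[OF assms(2-4)] by (auto simp: near_def)
  moreover have "g \<otimes> (inv h \<otimes> g) \<otimes> inv g = g \<otimes> inv h"
    using assms(3,4) by (simp add: m_assoc)
  ultimately show ?thesis using assms(3) by (simp add: near_def)
qed

definition gtop :: "'a topology" where
  "gtop = topology (\<lambda>W. W \<subseteq> carrier G \<and> (\<forall>w\<in>W. \<exists>n. \<forall>v\<in>carrier G. near n w v \<longrightarrow> v \<in> W))"

lemma openin_gtop:
  "openin gtop W \<longleftrightarrow> W \<subseteq> carrier G \<and> (\<forall>w\<in>W. \<exists>n. \<forall>v\<in>carrier G. near n w v \<longrightarrow> v \<in> W)"
proof -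
  have "istopology (\<lambda>W. W \<subseteq> carrier G \<and> (\<forall>w\<in>W. \<exists>n. \<forall>v\<in>carrier G. near n w v \<longrightarrow> v \<in> W))"
    unfolding istopology_def
  proof (intro conjI allI impI)
    fix S T
    assume S: "S \<subseteq> carrier G \<and> (\<forall>w\<in>S. \<exists>n. \<forall>v\<in>carrier G. near n w v \<longrightarrow> v \<in> S)"
      and T: "T \<subseteq> carrier G \<and> (\<forall>w\<in>T. \<exists>n. \<forall>v\<in>carrier G. near n w v \<longrightarrow> v \<in> T)"
    show "S \<inter> T \<subseteq> carrier G" using S by blast
    show "\<forall>w\<in>S \<inter> T. \<exists>n. \<forall>v\<in>carrier G. near n w v \<longrightarrow> v \<in> S \<inter> T"
    proof
      fix w assume "w \<in> S \<inter> T"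
      then obtain n m where "\<forall>v\<in>carrier G. near n w v \<longrightarrow> v \<in> S" "\<forall>v\<in>carrier G. near m w v \<longrightarrow> v \<in> T"
        using S T by blast
      then show "\<exists>n. \<forall>v\<in>carrier G. near n w v \<longrightarrow> v \<in> S \<inter> T"
        using near_antimono[of "max n m" w _ n] near_antimono[of "max n m" w _ m]
        by (intro exI[of _ "max n m"]) auto
    qed
  next
    fix \<K> assume K: "\<forall>K\<in>\<K>. K \<subseteq> carrier G \<and> (\<forall>w\<in>K. \<exists>n. \<forall>v\<in>carrier G. near n w v \<longrightarrow> v \<in> K)"
    then show "\<Union> \<K> \<subseteq> carrier G" by blast
    show "\<forall>w\<in>\<Union> \<K>. \<exists>n. \<forall>v\<in>carrier G. near n w v \<longrightarrow> v \<in> \<Union> \<K>" 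
    proof
      fix w assume "w \<in> \<Union> \<K>"
      then obtain S where "S \<in> \<K>" "w \<in> S" by blast
      then obtain n where "\<forall>v\<in>carrier G. near n w v \<longrightarrow> v \<in> S" using K by meson
      then show "\<exists>n. \<forall>v\<in>carrier G. near n w v \<longrightarrow> v \<in> \<Union> \<K>" using \<open>S \<in> \<K>\<close> by (intro exI[of _ n]) auto
    qed
  qed
  then show ?thesis by (simp add: gtop_def)
qed

lemma topspace_gtop [simp]: "topspace gtop = carrier G"
proof
  show "topspace gtop \<subseteq> carrier G" using openin_topspace[of gtop] unfolding openin_gtop by blast
  have "openin gtop (carrier G)" by (simp add: openin_gtop)
  then show "carrier G \<subseteq> topspace gtop" by (rule openin_subset)
qed

text \<open>A coset of \<open>U n\<close> need not be open. \<open>W\<close> is its interior, and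
  \<open>near_trans\<close> shows that a point with room \<open>m\<close> has neighbours with room
  \<open>Suc m\<close>.\<close>

lemma gtop_nbhd:
  assumes g: "g \<in> carrier G"
  obtains W where "openin gtop W" "g \<in> W" "\<And>v. v \<in> W \<Longrightarrow> near n g v"
proof -
  define W where "W = {w \<in> carrier G. \<exists>m. \<forall>v\<in>carrier G. near m w v \<longrightarrow> near n g v}"
  have "openin gtop W"
    unfolding openin_gtop
  proof (intro conjI ballI)
    fix w assume "w \<in> W"
    then obtain m where w: "w \<in> carrier G" and m: "\<And>v. v \<in> carrier G \<Longrightarrow> near m w v \<Longrightarrow> near n g v"
      by (auto simp: W_def)
    have "v \<in> W" if v: "v \<in> carrier G" "near (Suc m) w v" for v
      using m near_trans[OF v(2) _ w v(1)] v(1) by (auto simp: W_def intro!: exI[of _ "Suc m"])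
    then show "\<exists>n. \<forall>v\<in>carrier G. near n w v \<longrightarrow> v \<in> W" by blast
  qed (auto simp: W_def)
  moreover have "g \<in> W" using g by (auto simp: W_def)
  moreover have "near n g v" if "v \<in> W" for v using that near_refl by (auto simp: W_def)
  ultimately show ?thesis using that by blast
qed

lemma topological_group_gtop: "topological_group G gtop"
  unfolding topological_group_def
proof (intro conjI)
  show "group G" by (rule is_group)
  show "continuous_map (prod_topology gtop gtop) gtop (\<lambda>(x, y). x \<otimes> y)"
    unfolding continuous_map_def
  proof (intro conjI allI impI)
    fix W assume W: "openin gtop W"
    show "openin (prod_topology gtop gtop)
        {p \<in> topspace (prod_topology gtop gtop). (case p of (x, y) \<Rightarrow> x \<otimes> y) \<in> W}"
      unfolding openin_prod_topology_alt
    proof (intro allI impI)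
      fix x y assume "(x, y) \<in> {p \<in> topspace (prod_topology gtop gtop). (case p of (x, y) \<Rightarrow> x \<otimes> y) \<in> W}"
      then have x: "x \<in> carrier G" and y: "y \<in> carrier G" and xy: "x \<otimes> y \<in> W" by auto
      obtain n where n: "\<And>v. v \<in> carrier G \<Longrightarrow> near n (x \<otimes> y) v \<Longrightarrow> v \<in> W"
        using W xy unfolding openin_gtop by blast
      \<comment> \<open>The change from \<open>x \<otimes> y\<close> to \<open>p \<otimes> q\<close>
        goes through \<open>p \<otimes> y\<close>: first a right translation by \<open>y\<close>,
        hence the conjugation by \<open>inv y\<close>, then a left translation by
        \<open>p\<close>.\<close>
      obtain m where m: "\<forall>u\<in>U m. inv y \<otimes> u \<otimes> inv (inv y) \<in> U (Suc n)"
        using U_conj[of "inv y"] y by blast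
      obtain P where P: "openin gtop P" "x \<in> P" "\<And>v. v \<in> P \<Longrightarrow> near m x v" using gtop_nbhd[OF x, where n = m] by blast
      obtain Q where Q: "openin gtop Q" "y \<in> Q" "\<And>v. v \<in> Q \<Longrightarrow> near (Suc n) y v"
        using gtop_nbhd[OF y, where n = "Suc n"] by blast
      have PQ: "P \<subseteq> carrier G" "Q \<subseteq> carrier G" using P Q openin_subset by fastforce+
      have "p \<otimes> q \<in> W" if p: "p \<in> P" and q: "q \<in> Q" for p q
      proof -
        have pq: "p \<in> carrier G" "q \<in> carrier G" using p q PQ by auto
        have "near (Suc n) (x \<otimes> y) (p \<otimes> y)" using near_mult_right[OF m P(3)[OF p] y x pq(1)] .
        moreover have "near (Suc n) (p \<otimes> y) (p \<otimes> q)" using Q(3)[OF q] near_mult_left[OF pq(1) y pq(2)] by simp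
        ultimately have "near n (x \<otimes> y) (p \<otimes> q)" using near_trans[of n "x \<otimes> y" "p \<otimes> y"] x y pq by simp
        then show ?thesis using n pq by simp
      qed
      then show "\<exists>P Q. openin gtop P \<and> openin gtop Q \<and> x \<in> P \<and> y \<in> Q \<and>
          P \<times> Q \<subseteq> {p \<in> topspace (prod_topology gtop gtop). (case p of (x, y) \<Rightarrow> x \<otimes> y) \<in> W}"
        using P Q PQ by (intro exI[of _ P] exI[of _ Q]) auto
    qed
  qed auto
  show "continuous_map gtop gtop (\<lambda>x. inv x)"
    unfolding continuous_map_def
  proof (intro conjI allI impI)
    fix W assume W: "openin gtop W"
    show "openin gtop {x \<in> topspace gtop. inv x \<in> W}"
      unfolding openin_gtop
    proof (intro conjI ballI)
      fix x assume "x \<in> {x \<in> topspace gtop. inv x \<in> W}"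
      then have x: "x \<in> carrier G" "inv x \<in> W" by auto
      obtain n where n: "\<And>v. v \<in> carrier G \<Longrightarrow> near n (inv x) v \<Longrightarrow> v \<in> W"
        using W x unfolding openin_gtop by blast
      obtain m where m: "\<forall>u\<in>U m. x \<otimes> u \<otimes> inv x \<in> U n" using U_conj x by blast
      show "\<exists>n. \<forall>v\<in>carrier G. near n x v \<longrightarrow> v \<in> {x \<in> topspace gtop. inv x \<in> W}"
        using n near_inv[OF m] x by auto
    qed auto
  qed auto
qed simp

lemma Hausdorff_gtop:
  assumes "\<And>g. (\<And>n. g \<in> U n) \<Longrightarrow> g = \<one>"
  shows "Hausdorff_space gtop"
  unfolding Hausdorff_space_def
proof (intro allI impI, elim conjE)
  fix x y assume "x \<in> topspace gtop" "y \<in> topspace gtop" and xy: "x \<noteq> y"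
  then have x: "x \<in> carrier G" and y: "y \<in> carrier G" by auto
  have "inv x \<otimes> y \<noteq> \<one>" using x y xy by (metis inv_closed inv_equality inv_inv)
  then obtain n where n: "\<not> near n x y" using assms[of "inv x \<otimes> y"] by (auto simp: near_def)
  obtain P where P: "openin gtop P" "x \<in> P" "\<And>v. v \<in> P \<Longrightarrow> near (Suc n) x v"
    using gtop_nbhd[OF x, where n = "Suc n"] by blast
  obtain Q where Q: "openin gtop Q" "y \<in> Q" "\<And>v. v \<in> Q \<Longrightarrow> near (Suc n) y v"
    using gtop_nbhd[OF y, where n = "Suc n"] by blast
  have "v \<notin> Q" if v: "v \<in> P" for v
  proof
    assume vQ: "v \<in> Q"
    have "v \<in> carrier G" using v P openin_subset by fastforce
    then have "near n x y" using near_trans[OF P(3)[OF v] near_sym[OF Q(3)[OF vQ]]] x y by blast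
    then show False using n by simp
  qed
  then show "\<exists>P Q. openin gtop P \<and> openin gtop Q \<and> x \<in> P \<and> y \<in> Q \<and> disjnt P Q"
    using P Q by (intro exI[of _ P] exI[of _ Q]) (auto simp: disjnt_iff)
qed

lemma closure_of_gtop:
  assumes "S \<subseteq> carrier G"
  shows "g \<in> gtop closure_of S \<longleftrightarrow> g \<in> carrier G \<and> (\<forall>n. \<exists>s\<in>S. near n g s)"
proof (intro iffI conjI allI)
  assume g: "g \<in> gtop closure_of S"
  then show gc: "g \<in> carrier G" using closure_of_subset_topspace by fastforce
  fix n
  obtain W where "openin gtop W" "g \<in> W" "\<And>v. v \<in> W \<Longrightarrow> near n g v" using gtop_nbhd[OF gc, where n = n] by blast
  then show "\<exists>s\<in>S. near n g s" using g unfolding in_closure_of by blast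
next
  assume "g \<in> carrier G \<and> (\<forall>n. \<exists>s\<in>S. near n g s)"
  then have g: "g \<in> carrier G" and near: "\<And>n. \<exists>s\<in>S. near n g s" by blast+
  have "\<exists>s. s \<in> S \<and> s \<in> W" if W: "g \<in> W" "openin gtop W" for W
  proof -
    obtain n where "\<forall>v\<in>carrier G. near n g v \<longrightarrow> v \<in> W" using W unfolding openin_gtop by blast
    then show ?thesis using near[of n] assms by blast
  qed
  then show "g \<in> gtop closure_of S" using g by (auto simp: in_closure_of)
qed

section \<open>Completeness, total boundedness and compactness\<close>

definition cauchy_seq :: "(nat \<Rightarrow> 'a) \<Rightarrow> bool" where
  "cauchy_seq x \<longleftrightarrow> (\<forall>i. x i \<in> carrier G) \<and> (\<forall>n. \<exists>N. \<forall>i\<ge>N. \<forall>j\<ge>N. near n (x i) (x j))"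

text \<open>The countable basis lets sequences replace Cauchy filters.\<close>

definition seq_complete :: bool where
  "seq_complete \<longleftrightarrow> (\<forall>x. cauchy_seq x \<longrightarrow> (\<exists>g\<in>carrier G. \<forall>n. \<forall>\<^sub>F i in sequentially. near n g (x i)))"

text \<open>The centres range over \<open>G\<close> rather than \<open>T\<close>, so passage to
  subsets is immediate.\<close>

definition tot_bounded :: "'a set \<Rightarrow> bool" where
  "tot_bounded T \<longleftrightarrow> (\<forall>n. \<exists>F. finite F \<and> F \<subseteq> carrier G \<and> (\<forall>t\<in>T. \<exists>f\<in>F. near n f t))"

lemma tot_bounded_subset: "tot_bounded T \<Longrightarrow> S \<subseteq> T \<Longrightarrow> tot_bounded S"
  unfolding tot_bounded_def by (meson subsetD)

lemma tot_bounded_closure: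
  assumes T: "T \<subseteq> carrier G" and tb: "tot_bounded T"
  shows "tot_bounded (gtop closure_of T)"
  unfolding tot_bounded_def
proof
  fix n
  obtain F where F: "finite F" "F \<subseteq> carrier G" "\<And>t. t \<in> T \<Longrightarrow> \<exists>f\<in>F. near (Suc n) f t"
    using tb unfolding tot_bounded_def by meson
  have "\<exists>f\<in>F. near n f g" if gT: "g \<in> gtop closure_of T" for g
  proof -
    obtain t where g: "g \<in> carrier G" and t: "t \<in> T" "near (Suc n) g t"
      using gT closure_of_gtop[OF T] by blast
    obtain f where f: "f \<in> F" "near (Suc n) f t" using F t by blast
    then have "near n f g" using near_trans[OF f(2) near_sym[OF t(2) g]] F(2) T t g by blast
    then show ?thesis using f by blast
  qed
  then show "\<exists>F. finite F \<and> F \<subseteq> carrier G \<and> (\<forall>t\<in>gtop closure_of T. \<exists>f\<in>F. near n f t)" using F by blast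
qed

text \<open>Without a finite subcover, total boundedness yields nested parts of \<open>T\<close>,
  ever smaller and all without a finite subcover. Points chosen in them form a Cauchy sequence, and
  the cover member containing its limit swallows one of the parts.\<close>

lemma compactin_gtop:
  assumes comp: seq_complete and tb: "tot_bounded T" and closed: "closedin gtop T"
  shows "compactin gtop T"
  unfolding compactin_def
proof (intro conjI allI impI)
  have T: "T \<subseteq> carrier G" using closedin_subset[OF closed] by simp
  then show "T \<subseteq> topspace gtop" by simp
  fix \<W> assume W: "(\<forall>W\<in>\<W>. openin gtop W) \<and> T \<subseteq> \<Union> \<W>"
  define bad where "bad Z \<longleftrightarrow> \<not> (\<exists>\<F>. finite \<F> \<and> \<F> \<subseteq> \<W> \<and> Z \<subseteq> \<Union> \<F>)" for Z
  have "\<not> bad T"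
  proof
    assume badT: "bad T"
    have step: "\<exists>Z'. (Z' \<subseteq> T \<and> bad Z') \<and> Z' \<subseteq> Z \<and> (\<exists>f\<in>carrier G. \<forall>z\<in>Z'. near n f z)"
      if Z: "Z \<subseteq> T \<and> bad Z" for Z n
    proof -
      obtain F where F: "finite F" "F \<subseteq> carrier G" "\<And>t. t \<in> T \<Longrightarrow> \<exists>f\<in>F. near n f t"
        using tb unfolding tot_bounded_def by meson
      have "\<exists>f\<in>F. bad {z\<in>Z. near n f z}"
      proof (rule ccontr)
        assume "\<not> (\<exists>f\<in>F. bad {z\<in>Z. near n f z})"
        then have "\<forall>f\<in>F. \<exists>\<F>. finite \<F> \<and> \<F> \<subseteq> \<W> \<and> {z\<in>Z. near n f z} \<subseteq> \<Union> \<F>"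
          unfolding bad_def by blast
        from bchoice[OF this] obtain \<F> where \<F>: "\<forall>f\<in>F. finite (\<F> f) \<and> \<F> f \<subseteq> \<W> \<and> {z\<in>Z. near n f z} \<subseteq> \<Union> (\<F> f)" ..
        have "finite (\<Union>f\<in>F. \<F> f)" "(\<Union>f\<in>F. \<F> f) \<subseteq> \<W>" using \<F> F(1) by auto
        moreover have "Z \<subseteq> \<Union> (\<Union>f\<in>F. \<F> f)"
        proof
          fix z assume z: "z \<in> Z"
          then obtain f where "f \<in> F" "near n f z" using F(3) Z by blast
          then show "z \<in> \<Union> (\<Union>f\<in>F. \<F> f)" using bspec[OF \<F>, of f] z by blast
        qed
        ultimately show False using Z by (auto simp: bad_def)
      qed
      then obtain f where "f \<in> F" "bad {z\<in>Z. near n f z}" by blast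
      then show ?thesis using Z F(2) by (intro exI[of _ "{z\<in>Z. near n f z}"]) auto
    qed
    have "\<exists>Z. \<forall>n. (Z n \<subseteq> T \<and> bad (Z n)) \<and>
        (Z (Suc n) \<subseteq> Z n \<and> (\<exists>f\<in>carrier G. \<forall>z\<in>Z (Suc n). near n f z))"
      by (rule dependent_nat_choice) (use badT in blast, rule step)
    then obtain Z where "\<forall>n. (Z n \<subseteq> T \<and> bad (Z n)) \<and>
        (Z (Suc n) \<subseteq> Z n \<and> (\<exists>f\<in>carrier G. \<forall>z\<in>Z (Suc n). near n f z))" ..
    then have Z: "\<And>n. Z n \<subseteq> T \<and> bad (Z n)"
      and Zs: "\<And>n. Z (Suc n) \<subseteq> Z n \<and> (\<exists>f\<in>carrier G. \<forall>z\<in>Z (Suc n). near n f z)" by simp_all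
    have mono: "Z n \<subseteq> Z m" if "m \<le> n" for m n
      by (rule lift_Suc_antimono_le[of Z, OF _ that]) (simp add: Zs)
    \<comment> \<open>\<open>Z (Suc (Suc n))\<close> lies in one coset of index
      \<open>Suc n\<close>; comparison through its centre loses one more index.\<close>
    have small: "near n z z'" if zz: "z \<in> Z (Suc (Suc n))" "z' \<in> Z (Suc (Suc n))" for n z z'
    proof -
      obtain f where f: "f \<in> carrier G" "near (Suc n) f z" "near (Suc n) f z'" using Zs[of "Suc n"] zz by blast
      have "z \<in> carrier G" "z' \<in> carrier G" using zz Z T by blast+
      then show ?thesis using near_trans[OF near_sym[OF f(2,1)] f(3)] f(1) by blast
    qed
    have "\<exists>z. z \<in> Z n" for n using Z[of n] by (auto simp: bad_def)
    then obtain x where x: "\<And>n. x n \<in> Z n" by metis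
    have xZ: "x i \<in> Z n" if "n \<le> i" for i n using x mono[OF that] by blast
    have xc: "x i \<in> carrier G" for i using x Z T by blast
    have "cauchy_seq x" unfolding cauchy_seq_def using xc xZ small by blast
    then obtain g where g: "g \<in> carrier G" and lim: "\<And>n. \<forall>\<^sub>F i in sequentially. near n g (x i)"
      using comp unfolding seq_complete_def by blast
    have lim': "\<exists>i\<ge>N. near n g (x i)" for n N
      using lim[of n] unfolding eventually_sequentially by (meson nat_le_linear)
    have "g \<in> T"
    proof (rule ccontr)
      assume "g \<notin> T"
      moreover have "openin gtop (carrier G - T)" using closed by (simp add: closedin_def)
      ultimately obtain n where n: "\<forall>v\<in>carrier G. near n g v \<longrightarrow> v \<in> carrier G - T"
        using g unfolding openin_gtop by blast
      obtain i where "near n g (x i)" using lim' by blast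
      then show False using n xc x Z by blast
    qed
    then obtain W0 where W0: "W0 \<in> \<W>" "g \<in> W0" using W by blast
    then have "openin gtop W0" using W by blast
    then obtain n where n: "\<And>v. v \<in> carrier G \<Longrightarrow> near n g v \<Longrightarrow> v \<in> W0"
      using W0(2) unfolding openin_gtop by blast
    \<comment> \<open>From \<open>n + 3\<close> on, all of \<open>Z i\<close> is near
      \<open>x i\<close> at index \<open>Suc n\<close>, and one further step through
      \<open>x i\<close> reaches \<open>g\<close> at index \<open>n\<close>.\<close>
    obtain i where i: "i \<ge> Suc (Suc (Suc n))" "near (Suc n) g (x i)" using lim' by blast
    have "Z i \<subseteq> W0"
    proof
      fix z assume z: "z \<in> Z i"
      then have "near (Suc n) (x i) z" using small xZ[OF i(1)] mono[OF i(1)] by blast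
      moreover have "z \<in> carrier G" using z Z T by blast
      ultimately show "z \<in> W0" using n near_trans[OF i(2)] g xc by blast
    qed
    then have "\<not> bad (Z i)" unfolding bad_def using W0(1) by (auto intro!: exI[of _ "{W0}"])
    then show False using Z by blast
  qed
  then show "\<exists>\<F>. finite \<F> \<and> \<F> \<subseteq> \<W> \<and> T \<subseteq> \<Union> \<F>" unfolding bad_def by blast
qed

lemma tot_bounded_translate:
  assumes "tot_bounded (U 0)" "g \<in> carrier G"
  shows "tot_bounded {v \<in> carrier G. near 0 g v}"
  unfolding tot_bounded_def
proof
  fix n
  obtain F where F: "finite F" "F \<subseteq> carrier G" "\<And>t. t \<in> U 0 \<Longrightarrow> \<exists>f\<in>F. near n f t"
    using assms(1) unfolding tot_bounded_def by meson
  have "\<exists>f\<in>(\<lambda>f. g \<otimes> f) ` F. near n f v" if v: "v \<in> carrier G" "near 0 g v" for v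
  proof -
    obtain f where f: "f \<in> F" "near n f (inv g \<otimes> v)" using F(3) v(2) unfolding near_def by blast
    then have "near n (g \<otimes> f) (g \<otimes> (inv g \<otimes> v))" using near_mult_left[of g f] assms(2) F(2) v by blast
    moreover have "g \<otimes> (inv g \<otimes> v) = v" using assms(2) v by (simp add: m_assoc[symmetric])
    ultimately show ?thesis using f by auto
  qed
  then show "\<exists>F. finite F \<and> F \<subseteq> carrier G \<and> (\<forall>t\<in>{v \<in> carrier G. near 0 g v}. \<exists>f\<in>F. near n f t)"
    using F assms(2) by (intro exI[of _ "(\<lambda>f. g \<otimes> f) ` F"]) auto
qed

lemma locally_compact_gtop:
  assumes seq_complete "tot_bounded (U 0)"
  shows "locally_compact_space gtop"
  unfolding locally_compact_space_def
proof
  fix g assume "g \<in> topspace gtop"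
  then have g: "g \<in> carrier G" by simp
  obtain W where W: "openin gtop W" "g \<in> W" "\<And>v. v \<in> W \<Longrightarrow> near 0 g v" using gtop_nbhd[OF g, where n = 0] by blast
  have Wc: "W \<subseteq> carrier G" using openin_subset[OF W(1)] by simp
  have "tot_bounded W" using tot_bounded_subset[OF tot_bounded_translate[OF assms(2) g]] W Wc by blast
  then have "compactin gtop (gtop closure_of W)"
    using compactin_gtop[OF assms(1) tot_bounded_closure[OF Wc]] by simp
  moreover have "W \<subseteq> gtop closure_of W" using closure_of_subset Wc by (metis topspace_gtop)
  ultimately show "\<exists>U K. openin gtop U \<and> compactin gtop K \<and> g \<in> U \<and> U \<subseteq> K" using W by blast
qed

end

section \<open>Completion by Cauchy sequences\<close>

text \<open>\<open>U_conj_near\<close> makes the conjugation index uniform on a whole coset of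
  \<open>U 0\<close>. The pointwise control of \<open>U_conj\<close> is too weak for sequences:
  inverting or multiplying Cauchy sequences conjugates by all terms of a tail at once.
  \<open>tot_bounded_U\<close> becomes local compactness of the completion.\<close>

locale precompact_group_nbhd = group_nbhd +
  assumes U_conj_near: "g \<in> carrier G \<Longrightarrow> \<exists>m. \<forall>h\<in>carrier G. near 0 g h \<longrightarrow> (\<forall>u\<in>U m. h \<otimes> u \<otimes> inv h \<in> U n)"
    and tot_bounded_U: "tot_bounded (U 0)"
begin

lemma cauchy_seq_carrier: "cauchy_seq x \<Longrightarrow> x i \<in> carrier G"
  by (simp add: cauchy_seq_def)

lemma cauchy_seqD: "cauchy_seq x \<Longrightarrow> \<exists>N. \<forall>i\<ge>N. \<forall>j\<ge>N. near n (x i) (x j)"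
  by (simp add: cauchy_seq_def)

text \<open>A tail stays in the coset of \<open>U 0\<close> at a single term, where
  \<open>U_conj_near\<close> is uniform.\<close>

lemma cauchy_seq_conj:
  assumes x: "cauchy_seq x"
  shows "\<exists>m N. \<forall>i\<ge>N. \<forall>u\<in>U m. x i \<otimes> u \<otimes> inv (x i) \<in> U n"
proof -
  obtain N where N: "\<forall>i\<ge>N. near 0 (x N) (x i)"
    using cauchy_seqD[OF x, of 0] by (meson order.refl)
  obtain m where "\<forall>h\<in>carrier G. near 0 (x N) h \<longrightarrow> (\<forall>u\<in>U m. h \<otimes> u \<otimes> inv h \<in> U n)"
    using U_conj_near[OF cauchy_seq_carrier[OF x]] by meson
  then show ?thesis using N cauchy_seq_carrier[OF x] by (intro exI[of _ m] exI[of _ N]) simp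
qed

lemma cauchy_seq_const: "g \<in> carrier G \<Longrightarrow> cauchy_seq (\<lambda>_. g)"
  by (simp add: cauchy_seq_def near_refl)

lemma cauchy_seq_inv:
  assumes x: "cauchy_seq x"
  shows "cauchy_seq (\<lambda>i. inv (x i))"
proof -
  have "\<exists>N. \<forall>i\<ge>N. \<forall>j\<ge>N. near n (inv (x i)) (inv (x j))" for n
  proof -
    obtain m N where m: "\<forall>i\<ge>N. \<forall>u\<in>U m. x i \<otimes> u \<otimes> inv (x i) \<in> U n"
      using cauchy_seq_conj[OF x] by blast
    obtain N' where N': "\<And>i j. i \<ge> N' \<Longrightarrow> j \<ge> N' \<Longrightarrow> near m (x i) (x j)"
      using cauchy_seqD[OF x] by meson
    have "near n (inv (x i)) (inv (x j))" if "i \<ge> max N N'" "j \<ge> max N N'" for i j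
    proof (rule near_inv)
      show "\<forall>u\<in>U m. x i \<otimes> u \<otimes> inv (x i) \<in> U n" using m that by simp
      show "near m (x i) (x j)" using N' that by simp
    qed (auto simp: cauchy_seq_carrier[OF x])
    then show ?thesis by blast
  qed
  then show ?thesis using cauchy_seq_carrier[OF x] by (simp add: cauchy_seq_def)
qed

text \<open>Right translation by \<open>y i\<close> conjugates by its inverse, so the uniform index
  is taken for the inverse sequence.\<close>

lemma cauchy_seq_near_mult_right:
  assumes y: "cauchy_seq y"
  shows "\<exists>m N. \<forall>i\<ge>N. \<forall>g\<in>carrier G. \<forall>h\<in>carrier G. near m g h \<longrightarrow> near n (g \<otimes> y i) (h \<otimes> y i)"
proof -
  obtain m N where m: "\<forall>i\<ge>N. \<forall>u\<in>U m. inv (y i) \<otimes> u \<otimes> inv (inv (y i)) \<in> U n"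
    using cauchy_seq_conj[OF cauchy_seq_inv[OF y]] by blast
  show ?thesis
    by (rule exI[of _ m], rule exI[of _ N], intro allI impI ballI, rule near_mult_right[where m = m])
      (use m in \<open>auto simp: cauchy_seq_carrier[OF y]\<close>)
qed

lemma cauchy_seq_mult:
  assumes x: "cauchy_seq x" and y: "cauchy_seq y"
  shows "cauchy_seq (\<lambda>i. x i \<otimes> y i)"
proof -
  note c = cauchy_seq_carrier[OF x] cauchy_seq_carrier[OF y]
  have "\<exists>N. \<forall>i\<ge>N. \<forall>j\<ge>N. near n (x i \<otimes> y i) (x j \<otimes> y j)" for n
  proof -
    obtain m N where m: "\<forall>i\<ge>N. \<forall>g\<in>carrier G. \<forall>h\<in>carrier G. near m g h \<longrightarrow>
        near (Suc n) (g \<otimes> y i) (h \<otimes> y i)"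
      using cauchy_seq_near_mult_right[OF y] by blast
    obtain Nx where Nx: "\<And>i j. i \<ge> Nx \<Longrightarrow> j \<ge> Nx \<Longrightarrow> near m (x i) (x j)"
      using cauchy_seqD[OF x] by meson
    obtain Ny where Ny: "\<And>i j. i \<ge> Ny \<Longrightarrow> j \<ge> Ny \<Longrightarrow> near (Suc n) (y i) (y j)"
      using cauchy_seqD[OF y] by meson
    have "near n (x i \<otimes> y i) (x j \<otimes> y j)" if "i \<ge> max N (max Nx Ny)" "j \<ge> max N (max Nx Ny)" for i j
    proof (rule near_trans)
      show "near (Suc n) (x i \<otimes> y i) (x j \<otimes> y i)" using m Nx that c by simp
      show "near (Suc n) (x j \<otimes> y i) (x j \<otimes> y j)" using Ny that c by (simp add: near_mult_left)
    qed (use c in auto)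
    then show ?thesis by blast
  qed
  then show ?thesis using c by (simp add: cauchy_seq_def)
qed

section \<open>Equivalent Cauchy sequences and the completed group\<close>

definition seq_equiv :: "(nat \<Rightarrow> 'a) \<Rightarrow> (nat \<Rightarrow> 'a) \<Rightarrow> bool" where
  "seq_equiv x y \<longleftrightarrow> (\<forall>n. \<forall>\<^sub>F i in sequentially. near n (x i) (y i))"

lemma seq_equiv_refl: "cauchy_seq x \<Longrightarrow> seq_equiv x x"
  by (simp add: seq_equiv_def near_refl cauchy_seq_carrier)

lemma seq_equiv_sym:
  assumes "seq_equiv x y" "cauchy_seq x" "cauchy_seq y"
  shows "seq_equiv y x"
  unfolding seq_equiv_def
proof
  fix n
  have "\<forall>\<^sub>F i in sequentially. near n (x i) (y i)" using assms(1) by (simp add: seq_equiv_def)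
  then show "\<forall>\<^sub>F i in sequentially. near n (y i) (x i)"
    by eventually_elim (auto intro: near_sym simp: cauchy_seq_carrier assms)
qed

lemma seq_equiv_trans:
  assumes "seq_equiv x y" "seq_equiv y z" "cauchy_seq x" "cauchy_seq y" "cauchy_seq z"
  shows "seq_equiv x z"
  unfolding seq_equiv_def
proof
  fix n
  have "\<forall>\<^sub>F i in sequentially. near (Suc n) (x i) (y i)" "\<forall>\<^sub>F i in sequentially. near (Suc n) (y i) (z i)"
    using assms(1,2) by (simp_all add: seq_equiv_def)
  then show "\<forall>\<^sub>F i in sequentially. near n (x i) (z i)"
    by eventually_elim (rule near_trans, auto simp: cauchy_seq_carrier assms)
qed

lemma seq_equiv_mult:
  assumes "seq_equiv x x'" "seq_equiv y y'" "cauchy_seq x" "cauchy_seq y" "cauchy_seq x'" "cauchy_seq y'"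
  shows "seq_equiv (\<lambda>i. x i \<otimes> y i) (\<lambda>i. x' i \<otimes> y' i)"
  unfolding seq_equiv_def
proof
  fix n
  note c = assms(3-6)[THEN cauchy_seq_carrier]
  obtain m N where m: "\<forall>i\<ge>N. \<forall>g\<in>carrier G. \<forall>h\<in>carrier G. near m g h \<longrightarrow>
        near (Suc n) (g \<otimes> y i) (h \<otimes> y i)"
    using cauchy_seq_near_mult_right[OF assms(4)] by blast
  have "\<forall>\<^sub>F i in sequentially. near m (x i) (x' i)" "\<forall>\<^sub>F i in sequentially. near (Suc n) (y i) (y' i)"
    using assms(1,2) by (simp_all add: seq_equiv_def)
  with eventually_ge_at_top[of N] show "\<forall>\<^sub>F i in sequentially. near n (x i \<otimes> y i) (x' i \<otimes> y' i)"
  proof eventually_elim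
    case (elim i)
    have "near (Suc n) (x i \<otimes> y i) (x' i \<otimes> y i)" using m elim c by simp
    moreover have "near (Suc n) (x' i \<otimes> y i) (x' i \<otimes> y' i)" using elim c by (simp add: near_mult_left)
    ultimately show ?case using near_trans[of n "x i \<otimes> y i" "x' i \<otimes> y i"] c by simp
  qed
qed

text \<open>A Cauchy sequence is recorded only through the sets that eventually contain every sequence
  equivalent to it; this places the completion in the type \<^typ>\<open>'a set set\<close>.\<close>
definition limit_filter :: "(nat \<Rightarrow> 'a) \<Rightarrow> 'a set set" where
  "limit_filter x = {S. \<forall>y. cauchy_seq y \<longrightarrow> seq_equiv x y \<longrightarrow> (\<forall>\<^sub>F i in sequentially. y i \<in> S)}"

text \<open>Since \<open>limit_filter\<close> quantifies over all equivalent sequences, equivalence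
  gives equality at once. Conversely, a coset around a late term \<open>x N\<close> eventually
  contains every sequence equivalent to \<open>x\<close>, so it belongs to the common filter and
  eventually contains \<open>y\<close>.\<close>

lemma limit_filter_eq_iff:
  assumes x: "cauchy_seq x" and y: "cauchy_seq y"
  shows "limit_filter x = limit_filter y \<longleftrightarrow> seq_equiv x y"
proof
  assume "seq_equiv x y"
  then have "seq_equiv x z \<longleftrightarrow> seq_equiv y z" if "cauchy_seq z" for z
    using seq_equiv_trans seq_equiv_sym x y that by blast
  then show "limit_filter x = limit_filter y" by (auto simp: limit_filter_def)
next
  assume eq: "limit_filter x = limit_filter y"
  note c = cauchy_seq_carrier[OF x] cauchy_seq_carrier[OF y]
  show "seq_equiv x y"
    unfolding seq_equiv_def
  proof
    fix n
    obtain N where N: "\<And>i j. i \<ge> N \<Longrightarrow> j \<ge> N \<Longrightarrow> near (Suc (Suc n)) (x i) (x j)"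
      using cauchy_seqD[OF x] by meson
    have "{v. near (Suc n) (x N) v} \<in> limit_filter x"
      unfolding limit_filter_def
    proof (intro CollectI allI impI)
      fix z assume z: "cauchy_seq z" "seq_equiv x z"
      have "\<forall>\<^sub>F i in sequentially. near (Suc (Suc n)) (x i) (z i)" using z by (simp add: seq_equiv_def)
      with eventually_ge_at_top[of N] show "\<forall>\<^sub>F i in sequentially. z i \<in> {v. near (Suc n) (x N) v}"
      proof eventually_elim
        case (elim i)
        then show ?case
          using near_trans[OF N[of N i] elim(2)] c cauchy_seq_carrier[OF z(1)] by simp
      qed
    qed
    then have "\<forall>\<^sub>F i in sequentially. near (Suc n) (x N) (y i)"
      using y seq_equiv_refl[OF y] unfolding eq by (simp add: limit_filter_def)
    with eventually_ge_at_top[of N] show "\<forall>\<^sub>F i in sequentially. near n (x i) (y i)"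
    proof eventually_elim
      case (elim i)
      have "near (Suc n) (x i) (x N)" using near_antimono[OF N[of i N]] elim by simp
      then show ?case using near_trans elim c by blast
    qed
  qed
qed

definition representative :: "'a set set \<Rightarrow> nat \<Rightarrow> 'a" where
  "representative = inv_into {x. cauchy_seq x} limit_filter"

definition completion :: "'a set set monoid" where
  "completion = \<lparr>carrier = limit_filter ` {x. cauchy_seq x},
     monoid.mult = (\<lambda>a b. limit_filter (\<lambda>i. representative a i \<otimes> representative b i)),
     one = limit_filter (\<lambda>_. \<one>)\<rparr>"

text \<open>Only some representative has to lie eventually in \<open>U n\<close>; an arbitrary
  representative is controlled after the loss of one index, as in \<open>hat_nearD\<close>.\<close>

definition completion_nbhd :: "nat \<Rightarrow> 'a set set set" where
  "completion_nbhd n = limit_filter ` {x. cauchy_seq x \<and> (\<forall>\<^sub>F i in sequentially. x i \<in> U n)}"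

lemma carrier_completion: "carrier completion = limit_filter ` {x. cauchy_seq x}"
  by (simp add: completion_def)

lemma limit_filter_carrier [simp]: "cauchy_seq x \<Longrightarrow> limit_filter x \<in> carrier completion"
  by (auto simp: carrier_completion)

lemma one_completion: "\<one>\<^bsub>completion\<^esub> = limit_filter (\<lambda>_. \<one>)"
  by (simp add: completion_def)

lemma mult_limit_filter:
  assumes x: "cauchy_seq x" and y: "cauchy_seq y"
  shows "limit_filter x \<otimes>\<^bsub>completion\<^esub> limit_filter y = limit_filter (\<lambda>i. x i \<otimes> y i)"
proof -
  have rep: "cauchy_seq (representative (limit_filter z))"
    "seq_equiv (representative (limit_filter z)) z" if "cauchy_seq z" for z
  proof -
    have "limit_filter z \<in> limit_filter ` {x. cauchy_seq x}" using that by blast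
    from inv_into_into[OF this] f_inv_into_f[OF this]
    show "cauchy_seq (representative (limit_filter z))" "seq_equiv (representative (limit_filter z)) z"
      using that limit_filter_eq_iff unfolding representative_def by auto
  qed
  have "seq_equiv (\<lambda>i. representative (limit_filter x) i \<otimes> representative (limit_filter y) i) (\<lambda>i. x i \<otimes> y i)"
    using seq_equiv_mult rep x y by blast
  then show ?thesis
    using rep x y by (simp add: completion_def limit_filter_eq_iff cauchy_seq_mult)
qed

lemma group_completion: "group completion"
proof (rule groupI)
  fix a b c assume "a \<in> carrier completion" "b \<in> carrier completion" "c \<in> carrier completion"
  then obtain x y z where xyz: "cauchy_seq x" "cauchy_seq y" "cauchy_seq z"
    and abc: "a = limit_filter x" "b = limit_filter y" "c = limit_filter z"
    by (auto simp: carrier_completion)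
  show "a \<otimes>\<^bsub>completion\<^esub> b \<otimes>\<^bsub>completion\<^esub> c = a \<otimes>\<^bsub>completion\<^esub> (b \<otimes>\<^bsub>completion\<^esub> c)"
    unfolding abc using xyz
    by (simp add: mult_limit_filter cauchy_seq_mult m_assoc cauchy_seq_carrier)
next
  fix a b assume "a \<in> carrier completion" "b \<in> carrier completion"
  then show "a \<otimes>\<^bsub>completion\<^esub> b \<in> carrier completion"
    by (auto simp: carrier_completion mult_limit_filter intro: cauchy_seq_mult)
next
  show "\<one>\<^bsub>completion\<^esub> \<in> carrier completion"
    by (simp add: one_completion cauchy_seq_const)
next
  fix a assume "a \<in> carrier completion"
  then obtain x where x: "cauchy_seq x" "a = limit_filter x" by (auto simp: carrier_completion)
  show "\<one>\<^bsub>completion\<^esub> \<otimes>\<^bsub>completion\<^esub> a = a"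
    using x by (simp add: one_completion mult_limit_filter cauchy_seq_const cauchy_seq_carrier)
  have "limit_filter (\<lambda>i. inv (x i)) \<otimes>\<^bsub>completion\<^esub> a = \<one>\<^bsub>completion\<^esub>"
    using x by (simp add: one_completion mult_limit_filter cauchy_seq_inv cauchy_seq_carrier)
  then show "\<exists>b\<in>carrier completion. b \<otimes>\<^bsub>completion\<^esub> a = \<one>\<^bsub>completion\<^esub>"
    using x cauchy_seq_inv limit_filter_carrier by blast
qed

lemma inv_limit_filter:
  assumes x: "cauchy_seq x"
  shows "inv\<^bsub>completion\<^esub> (limit_filter x) = limit_filter (\<lambda>i. inv (x i))"
  using x group.inv_equality[OF group_completion, of "limit_filter (\<lambda>i. inv (x i))" "limit_filter x"]
  by (simp add: one_completion mult_limit_filter cauchy_seq_inv cauchy_seq_carrier)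

text \<open>The axioms are checked termwise on representatives; conjugation needs an index that is
  uniform along a tail, supplied by \<open>cauchy_seq_conj\<close>.\<close>

sublocale hat: group_nbhd completion completion_nbhd
proof (intro group_nbhd.intro group_completion group_nbhd_axioms.intro)
  fix n
  show "completion_nbhd n \<subseteq> carrier completion"
    by (auto simp: completion_nbhd_def carrier_completion)
  show "\<one>\<^bsub>completion\<^esub> \<in> completion_nbhd n"
    by (auto simp: completion_nbhd_def one_completion cauchy_seq_const one_U)
  show "completion_nbhd (Suc n) \<subseteq> completion_nbhd n"
    unfolding completion_nbhd_def by (intro image_mono Collect_mono) (use U_Suc[of n] in \<open>auto elim: eventually_mono\<close>)
next
  fix a n assume "a \<in> completion_nbhd n"
  then obtain x where x: "cauchy_seq x" "a = limit_filter x" "\<forall>\<^sub>F i in sequentially. x i \<in> U n"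
    by (auto simp: completion_nbhd_def)
  have "\<forall>\<^sub>F i in sequentially. inv (x i) \<in> U n" using x(3) by eventually_elim (rule U_inv)
  then show "inv\<^bsub>completion\<^esub> a \<in> completion_nbhd n"
    using x cauchy_seq_inv by (auto simp: completion_nbhd_def inv_limit_filter)
next
  fix a b n assume "a \<in> completion_nbhd (Suc n)" "b \<in> completion_nbhd (Suc n)"
  then obtain x y where x: "cauchy_seq x" "a = limit_filter x" "\<forall>\<^sub>F i in sequentially. x i \<in> U (Suc n)"
    and y: "cauchy_seq y" "b = limit_filter y" "\<forall>\<^sub>F i in sequentially. y i \<in> U (Suc n)"
    by (auto simp: completion_nbhd_def)
  have "\<forall>\<^sub>F i in sequentially. x i \<otimes> y i \<in> U n" using x(3) y(3) by eventually_elim (rule U_mult)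
  then show "a \<otimes>\<^bsub>completion\<^esub> b \<in> completion_nbhd n"
    using x y cauchy_seq_mult by (auto simp: completion_nbhd_def mult_limit_filter)
next
  fix a n assume "a \<in> carrier completion"
  then obtain x where x: "cauchy_seq x" "a = limit_filter x" by (auto simp: carrier_completion)
  obtain m N where m: "\<forall>i\<ge>N. \<forall>u\<in>U m. x i \<otimes> u \<otimes> inv (x i) \<in> U n"
    using cauchy_seq_conj[OF x(1)] by blast
  have "a \<otimes>\<^bsub>completion\<^esub> b \<otimes>\<^bsub>completion\<^esub> inv\<^bsub>completion\<^esub> a \<in> completion_nbhd n" if b: "b \<in> completion_nbhd m" for b
  proof -
    obtain y where y: "cauchy_seq y" "b = limit_filter y" "\<forall>\<^sub>F i in sequentially. y i \<in> U m"
      using b by (auto simp: completion_nbhd_def)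
    have "\<forall>\<^sub>F i in sequentially. x i \<otimes> y i \<otimes> inv (x i) \<in> U n"
      using y(3) eventually_ge_at_top[of N] by eventually_elim (simp add: m)
    moreover have "cauchy_seq (\<lambda>i. x i \<otimes> y i \<otimes> inv (x i))"
      using x y by (intro cauchy_seq_mult cauchy_seq_inv)
    ultimately show ?thesis
      using x y by (simp add: inv_limit_filter mult_limit_filter cauchy_seq_mult cauchy_seq_inv)
        (auto simp: completion_nbhd_def intro!: imageI cauchy_seq_mult cauchy_seq_inv)
  qed
  then show "\<exists>m. \<forall>u\<in>completion_nbhd m. a \<otimes>\<^bsub>completion\<^esub> u \<otimes>\<^bsub>completion\<^esub> inv\<^bsub>completion\<^esub> a \<in> completion_nbhd n"
    by blast
qed

lemma hat_nearI:
  assumes "cauchy_seq x" "cauchy_seq y" "\<forall>\<^sub>F i in sequentially. near n (x i) (y i)"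
  shows "hat.near n (limit_filter x) (limit_filter y)"
  using assms cauchy_seq_mult[OF cauchy_seq_inv]
  by (auto simp: hat.near_def inv_limit_filter mult_limit_filter cauchy_seq_inv completion_nbhd_def near_def)

text \<open>The neighbourhood condition is witnessed by another sequence \<open>z\<close> equivalent
  to \<open>inv (x i) \<otimes> y i\<close>. The correction from \<open>z i\<close> lies eventually
  in \<open>U (Suc n)\<close> too, so the product lands in \<open>U n\<close>.\<close>

lemma hat_nearD:
  assumes x: "cauchy_seq x" and y: "cauchy_seq y" and near: "hat.near (Suc n) (limit_filter x) (limit_filter y)"
  shows "\<forall>\<^sub>F i in sequentially. near n (x i) (y i)"
proof -
  note c = cauchy_seq_carrier[OF x] cauchy_seq_carrier[OF y]
  have xy: "cauchy_seq (\<lambda>i. inv (x i) \<otimes> y i)" using x y by (intro cauchy_seq_mult cauchy_seq_inv)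
  obtain z where z: "cauchy_seq z" "limit_filter (\<lambda>i. inv (x i) \<otimes> y i) = limit_filter z"
    "\<forall>\<^sub>F i in sequentially. z i \<in> U (Suc n)"
    using near x y by (auto simp: hat.near_def inv_limit_filter mult_limit_filter cauchy_seq_inv completion_nbhd_def)
  have "\<forall>\<^sub>F i in sequentially. near (Suc n) (z i) (inv (x i) \<otimes> y i)"
    using limit_filter_eq_iff[OF z(1) xy] z(2) by (simp add: seq_equiv_def)
  with z(3) show ?thesis
  proof eventually_elim
    case (elim i)
    have "z i \<otimes> (inv (z i) \<otimes> (inv (x i) \<otimes> y i)) \<in> U n" using U_mult elim by (simp add: near_def)
    moreover have "z i \<otimes> (inv (z i) \<otimes> (inv (x i) \<otimes> y i)) = inv (x i) \<otimes> y i"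
      using c cauchy_seq_carrier[OF z(1)] by (simp add: m_assoc[symmetric])
    ultimately show ?case by (simp add: near_def)
  qed
qed

section \<open>Dense image, completeness and compactness in the completion\<close>

definition embed :: "'a \<Rightarrow> 'a set set" where
  "embed g = limit_filter (\<lambda>_. g)"

lemma embed_carrier: "g \<in> carrier G \<Longrightarrow> embed g \<in> carrier completion"
  by (simp add: embed_def cauchy_seq_const)

lemma embed_hom: "embed \<in> hom G completion"
  by (rule homI) (simp_all add: embed_def cauchy_seq_const mult_limit_filter)

lemma hat_near_embedI: "near n g h \<Longrightarrow> g \<in> carrier G \<Longrightarrow> h \<in> carrier G \<Longrightarrow> hat.near n (embed g) (embed h)"
  unfolding embed_def by (rule hat_nearI) (auto simp: cauchy_seq_const)

lemma hat_near_embedD: "hat.near (Suc n) (embed g) (embed h) \<Longrightarrow> g \<in> carrier G \<Longrightarrow> h \<in> carrier G \<Longrightarrow> near n g h"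
  using hat_nearD[of "\<lambda>_. g" "\<lambda>_. h" n] by (simp add: embed_def cauchy_seq_const)

lemma embed_tendsto:
  assumes x: "cauchy_seq x"
  shows "\<forall>\<^sub>F k in sequentially. hat.near n (limit_filter x) (embed (x k))"
proof -
  obtain N where N: "\<And>i j. i \<ge> N \<Longrightarrow> j \<ge> N \<Longrightarrow> near n (x i) (x j)" using cauchy_seqD[OF x] by meson
  have "hat.near n (limit_filter x) (embed (x k))" if k: "k \<ge> N" for k
    unfolding embed_def
  proof (rule hat_nearI[OF x])
    show "cauchy_seq (\<lambda>_. x k)" by (simp add: cauchy_seq_const cauchy_seq_carrier x)
    show "\<forall>\<^sub>F i in sequentially. near n (x i) (x k)"
      using eventually_ge_at_top[of N] by eventually_elim (rule N, simp, rule k)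
  qed
  then show ?thesis unfolding eventually_sequentially by blast
qed

lemma embed_dense:
  assumes "a \<in> carrier completion"
  obtains g where "g \<in> carrier G" "hat.near n a (embed g)"
proof -
  obtain x where x: "cauchy_seq x" "a = limit_filter x" using assms by (auto simp: carrier_completion)
  obtain k where "hat.near n a (embed (x k))"
    using embed_tendsto[OF x(1), of n] x(2) unfolding eventually_sequentially by blast
  then show ?thesis using that cauchy_seq_carrier[OF x(1)] by blast
qed

text \<open>A diagonal choice: \<open>x k\<close> in \<open>G\<close> approximates the term
  \<open>\<xi> k\<close> at index \<open>k\<close>, and the class of the sequence \<open>x\<close>
  is the limit.\<close>

lemma hat_complete: "hat.seq_complete"
  unfolding hat.seq_complete_def
proof (intro allI impI)
  fix \<xi> assume \<xi>: "hat.cauchy_seq \<xi>"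
  then have c: "\<xi> k \<in> carrier completion" for k by (simp add: hat.cauchy_seq_def)
  have "\<exists>g. g \<in> carrier G \<and> hat.near k (\<xi> k) (embed g)" for k
    using embed_dense[OF c, where n = k] by blast
  then obtain x where x: "\<And>k. x k \<in> carrier G" "\<And>k. hat.near k (\<xi> k) (embed (x k))" by metis
  note ec = embed_carrier[OF x(1)]
  have close: "hat.near n (\<xi> k) (embed (x k))" if "k \<ge> n" for k n
    by (rule hat.near_antimono[OF x(2) that])
  have "\<exists>N. \<forall>i\<ge>N. \<forall>j\<ge>N. near n (x i) (x j)" for n
  proof -
    \<comment> \<open>Two transitivity steps and the return from the completion to \<open>G\<close>
      cost one index each.\<close>
    define m where "m = Suc (Suc (Suc n))"
    obtain N where N: "\<And>i j. i \<ge> N \<Longrightarrow> j \<ge> N \<Longrightarrow> hat.near m (\<xi> i) (\<xi> j)"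
      using \<xi> unfolding hat.cauchy_seq_def by meson
    have "near n (x i) (x j)" if ij: "i \<ge> max N m" "j \<ge> max N m" for i j
    proof -
      have 1: "hat.near m (embed (x i)) (\<xi> i)"
        using hat.near_sym[OF close c ec] ij by simp
      have 2: "hat.near m (\<xi> i) (\<xi> j)" using N ij by simp
      have 3: "hat.near m (\<xi> j) (embed (x j))" using close ij by simp
      have "hat.near (Suc (Suc n)) (embed (x i)) (\<xi> j)"
        using hat.near_trans[OF 1[unfolded m_def] 2[unfolded m_def] ec c c] .
      moreover have "hat.near (Suc (Suc n)) (\<xi> j) (embed (x j))" using hat.near_antimono[OF 3] by (simp add: m_def)
      ultimately have "hat.near (Suc n) (embed (x i)) (embed (x j))" using hat.near_trans ec c by blast
      then show ?thesis using hat_near_embedD x(1) by blast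
    qed
    then show ?thesis by blast
  qed
  then have cx: "cauchy_seq x" using x(1) by (simp add: cauchy_seq_def)
  have "\<forall>\<^sub>F k in sequentially. hat.near n (limit_filter x) (\<xi> k)" for n
    using embed_tendsto[OF cx, of "Suc n"] eventually_ge_at_top[of "Suc n"]
  proof eventually_elim
    case (elim k)
    have "hat.near (Suc n) (embed (x k)) (\<xi> k)" using hat.near_sym[OF close c ec] elim by simp
    then show ?case using hat.near_trans[OF elim(1)] ec c cx limit_filter_carrier by blast
  qed
  then show "\<exists>g\<in>carrier completion. \<forall>n. \<forall>\<^sub>F i in sequentially. hat.near n g (\<xi> i)"
    using cx limit_filter_carrier by blast
qed

text \<open>A late term lying in \<open>U 0\<close> is near some centre of a finite net for
  \<open>U 0\<close>; that centre is then near the whole tail.\<close>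

lemma hat_tot_bounded: "hat.tot_bounded (completion_nbhd 0)"
  unfolding hat.tot_bounded_def
proof
  fix n
  obtain F where F: "finite F" "F \<subseteq> carrier G" "\<And>t. t \<in> U 0 \<Longrightarrow> \<exists>f\<in>F. near (Suc n) f t"
    using tot_bounded_U unfolding tot_bounded_def by meson
  have "\<exists>f\<in>embed ` F. hat.near n f a" if a: "a \<in> completion_nbhd 0" for a
  proof -
    obtain x where x: "cauchy_seq x" "a = limit_filter x" "\<forall>\<^sub>F i in sequentially. x i \<in> U 0"
      using a by (auto simp: completion_nbhd_def)
    obtain N where N: "\<And>i j. i \<ge> N \<Longrightarrow> j \<ge> N \<Longrightarrow> near (Suc n) (x i) (x j)" using cauchy_seqD[OF x(1)] by meson
    obtain k where k: "k \<ge> N" "x k \<in> U 0"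
      using x(3) unfolding eventually_sequentially by (meson nat_le_linear)
    obtain f where f: "f \<in> F" "near (Suc n) f (x k)" using F(3) k by blast
    have fc: "f \<in> carrier G" using f F by blast
    have "\<forall>\<^sub>F i in sequentially. near n f (x i)"
      using eventually_ge_at_top[of N]
      by eventually_elim (rule near_trans[OF f(2) N[OF k(1)] fc cauchy_seq_carrier[OF x(1)] cauchy_seq_carrier[OF x(1)]])
    then have "hat.near n (embed f) a"
      unfolding x(2) embed_def using hat_nearI x(1) cauchy_seq_const[OF fc] by blast
    then show ?thesis using f by blast
  qed
  then show "\<exists>F. finite F \<and> F \<subseteq> carrier completion \<and> (\<forall>t\<in>completion_nbhd 0. \<exists>f\<in>F. hat.near n f t)"
    using F embed_carrier by (intro exI[of _ "embed ` F"]) auto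
qed

text \<open>A point of every neighbourhood is represented by a sequence equivalent to the constant
  identity, and equivalent sequences are identified, even if the sets \<open>U n\<close> have a
  nontrivial intersection in \<open>G\<close>.\<close>

lemma hat_Hausdorff: "Hausdorff_space hat.gtop"
proof (rule hat.Hausdorff_gtop)
  fix a assume a: "\<And>n. a \<in> completion_nbhd n"
  then have "a \<in> carrier completion" using hat.U_carrier by blast
  then obtain x where x: "cauchy_seq x" "a = limit_filter x" by (auto simp: carrier_completion)
  have "inv\<^bsub>completion\<^esub> \<one>\<^bsub>completion\<^esub> \<otimes>\<^bsub>completion\<^esub> a = a" using x by simp
  then have "hat.near (Suc n) (limit_filter (\<lambda>_. \<one>)) (limit_filter x)" for n
    using a x(2) by (simp add: hat.near_def one_completion)
  then have "seq_equiv (\<lambda>_. \<one>) x"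
    using hat_nearD x(1) by (simp add: seq_equiv_def cauchy_seq_const)
  then show "a = \<one>\<^bsub>completion\<^esub>"
    using limit_filter_eq_iff[of "\<lambda>_. \<one>" x] x by (simp add: one_completion cauchy_seq_const)
qed

lemma hat_dense: "hat.gtop closure_of (embed ` carrier G) = topspace hat.gtop"
proof -
  have sub: "embed ` carrier G \<subseteq> carrier completion" using embed_carrier by blast
  have "a \<in> hat.gtop closure_of (embed ` carrier G)" if "a \<in> carrier completion" for a
    unfolding hat.closure_of_gtop[OF sub] using that embed_dense[OF that] by blast
  then show ?thesis using closure_of_subset_topspace[of hat.gtop] by auto
qed

text \<open>Covering by finitely many cosets of \<open>U 0\<close> is the group-side form of
  boundedness. Such a covering refines to every index because \<open>U 0\<close> is totally
  bounded.\<close>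

lemma hat_bounded_iff_compact:
  assumes T: "T \<subseteq> carrier G"
  shows "(\<exists>F. finite F \<and> F \<subseteq> carrier G \<and> (\<forall>t\<in>T. \<exists>f\<in>F. near 0 f t)) \<longleftrightarrow>
    compactin hat.gtop (hat.gtop closure_of (embed ` T))"
proof
  have sub: "embed ` T \<subseteq> carrier completion" using embed_carrier T by blast
  {
    assume "\<exists>F. finite F \<and> F \<subseteq> carrier G \<and> (\<forall>t\<in>T. \<exists>f\<in>F. near 0 f t)"
    then obtain F where F: "finite F" "F \<subseteq> carrier G" "\<And>t. t \<in> T \<Longrightarrow> \<exists>f\<in>F. near 0 f t" by blast
    have "hat.tot_bounded (embed ` T)"
      unfolding hat.tot_bounded_def
    proof
      fix n
      have "\<forall>f\<in>F. \<exists>P. finite P \<and> P \<subseteq> carrier G \<and> (\<forall>t\<in>{v \<in> carrier G. near 0 f v}. \<exists>p\<in>P. near n p t)"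
      proof
        fix f assume "f \<in> F"
        then have "tot_bounded {v \<in> carrier G. near 0 f v}"
          using tot_bounded_translate[OF tot_bounded_U, of f] F(2) by blast
        then show "\<exists>P. finite P \<and> P \<subseteq> carrier G \<and> (\<forall>t\<in>{v \<in> carrier G. near 0 f v}. \<exists>p\<in>P. near n p t)"
          unfolding tot_bounded_def ..
      qed
      from bchoice[OF this] obtain P where P: "\<forall>f\<in>F. finite (P f) \<and> P f \<subseteq> carrier G \<and>
          (\<forall>t\<in>{v \<in> carrier G. near 0 f v}. \<exists>p\<in>P f. near n p t)" ..
      define Q where "Q = (\<Union>f\<in>F. P f)"
      have Q: "finite Q" "Q \<subseteq> carrier G" using P F(1) by (auto simp: Q_def)
      have "\<exists>q\<in>embed ` Q. hat.near n q (embed t)" if t: "t \<in> T" for t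
      proof -
        have tc: "t \<in> carrier G" using t T by blast
        obtain f where f: "f \<in> F" "near 0 f t" using F(3) t by blast
        then obtain p where p: "p \<in> P f" "near n p t" using bspec[OF P, of f] tc by blast
        then have "p \<in> Q" using f by (auto simp: Q_def)
        then show ?thesis using hat_near_embedI[OF p(2)] Q(2) tc by blast
      qed
      then show "\<exists>F. finite F \<and> F \<subseteq> carrier completion \<and> (\<forall>t\<in>embed ` T. \<exists>f\<in>F. hat.near n f t)"
        using Q embed_carrier by (intro exI[of _ "embed ` Q"]) auto
    qed
    then show "compactin hat.gtop (hat.gtop closure_of (embed ` T))"
      using hat.compactin_gtop[OF hat_complete hat.tot_bounded_closure[OF sub]] by simp
  next
    assume comp: "compactin hat.gtop (hat.gtop closure_of (embed ` T))"
    \<comment> \<open>Density makes these open sets cover the completion. Index \<open>Suc 0\<close>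
      leaves one to spend on \<open>hat_near_embedD\<close>, which returns to \<open>G\<close> at
      index 0.\<close>
    define \<W> where "\<W> = {W. openin hat.gtop W \<and> (\<exists>g\<in>carrier G. \<forall>w\<in>W. hat.near (Suc 0) (embed g) w)}"
    have "a \<in> \<Union> \<W>" if a: "a \<in> carrier completion" for a
    proof -
      obtain W where W: "openin hat.gtop W" "a \<in> W" "\<And>v. v \<in> W \<Longrightarrow> hat.near (Suc (Suc 0)) a v"
        using hat.gtop_nbhd[OF a, where n = "Suc (Suc 0)"] by blast
      obtain g where g: "g \<in> carrier G" "hat.near (Suc (Suc 0)) a (embed g)"
        using embed_dense[OF a, where n = "Suc (Suc 0)"] by blast
      have "hat.near (Suc 0) (embed g) w" if w: "w \<in> W" for w
      proof -
        have "w \<in> carrier completion" using w openin_subset[OF W(1)] by auto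
        then show ?thesis
          using hat.near_trans[OF hat.near_sym[OF g(2) a] W(3)[OF w]] a embed_carrier[OF g(1)] by blast
      qed
      then have "W \<in> \<W>" using W(1) g(1) unfolding \<W>_def by blast
      then show ?thesis using W(2) by blast
    qed
    then have "carrier completion \<subseteq> \<Union> \<W>" by blast
    then have "hat.gtop closure_of (embed ` T) \<subseteq> \<Union> \<W>"
      using closure_of_subset_topspace[of hat.gtop "embed ` T"] by (simp only: hat.topspace_gtop)
    then obtain \<F> where \<F>: "finite \<F>" "\<F> \<subseteq> \<W>" "hat.gtop closure_of (embed ` T) \<subseteq> \<Union> \<F>"
      using compactinD[OF comp, of \<W>] by (auto simp: \<W>_def)
    have "\<forall>W\<in>\<F>. \<exists>g. g \<in> carrier G \<and> (\<forall>w\<in>W. hat.near (Suc 0) (embed g) w)"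
      using \<F>(2) unfolding \<W>_def by blast
    from bchoice[OF this] obtain c where c: "\<forall>W\<in>\<F>. c W \<in> carrier G \<and> (\<forall>w\<in>W. hat.near (Suc 0) (embed (c W)) w)" ..
    have "\<exists>f\<in>c ` \<F>. near 0 f t" if t: "t \<in> T" for t
    proof -
      have "embed t \<in> hat.gtop closure_of (embed ` T)"
        using closure_of_subset[of "embed ` T" hat.gtop] sub t by auto
      then obtain W where W: "W \<in> \<F>" "embed t \<in> W" using \<F>(3) by blast
      then have "hat.near (Suc 0) (embed (c W)) (embed t)" "c W \<in> carrier G" using c by blast+
      then have "near 0 (c W) t" using hat_near_embedD t T by blast
      then show ?thesis using W by blast
    qed
    then show "\<exists>F. finite F \<and> F \<subseteq> carrier G \<and> (\<forall>t\<in>T. \<exists>f\<in>F. near 0 f t)"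
      using \<F>(1) c by (intro exI[of _ "c ` \<F>"]) auto
  }
qed

end

section \<open>Tame quasi-actions\<close>

text \<open>The constant bounding \<open>dist (act g z) z\<close> in \<open>tame\<close> dominates all displacement errors that arise
  below from products, conjugates and the covering argument.\<close>
locale tame_quasi_action = group G for G (structure) +
  fixes act :: "'a \<Rightarrow> 'b::metric_space \<Rightarrow> 'b" and K A B R :: real and x0 :: 'b
  assumes qa: "quasi_action G act K A" and AB: "A \<le> B" and R: "0 < R"
    and proper: "compact (cball (x :: 'b) r)"
    and tame: "g \<in> carrier G \<Longrightarrow>
      (\<And>z. z \<in> cball y R \<Longrightarrow> dist (act g z) z \<le> K * (2 * K + 3 * A + 2 + B) + 5 * A + B) \<Longrightarrow>
      dist (act g y) y \<le> B"
begin

lemma K: "1 \<le> K" and A: "0 \<le> A"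
  using qa by (auto simp: quasi_action_def)

lemma B: "0 \<le> B"
  using A AB by simp

lemma act_lipschitz: "g \<in> carrier G \<Longrightarrow> dist (act g x) (act g y) \<le> K * dist x y + A"
  using qa by (auto simp: quasi_action_def quasi_isometry_def)

lemma act_mult: "g \<in> carrier G \<Longrightarrow> h \<in> carrier G \<Longrightarrow> dist (act h (act g x)) (act (h \<otimes> g) x) \<le> A"
  using qa by (auto simp: quasi_action_def)

lemma act_one: "dist (act \<one> x) x \<le> A"
  using qa by (auto simp: quasi_action_def)

lemma act_lipschitz_le:
  assumes "g \<in> carrier G" "dist x y \<le> c"
  shows "dist (act g x) (act g y) \<le> K * c + A"
proof -
  have "K * dist x y \<le> K * c" using assms(2) K by (intro mult_left_mono) auto
  then show ?thesis using act_lipschitz[OF assms(1), of x y] by linarith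
qed

lemma act_inv_left: "g \<in> carrier G \<Longrightarrow> dist (act (inv g) (act g x)) x \<le> 2 * A"
  using act_mult[of g "inv g" x] act_one[of x] dist_triangle[of "act (inv g) (act g x)" x "act \<one> x"] by simp

lemma act_inv_right: "g \<in> carrier G \<Longrightarrow> dist (act g (act (inv g) x)) x \<le> 2 * A"
  using act_mult[of "inv g" g x] act_one[of x] dist_triangle[of "act g (act (inv g) x)" x "act \<one> x"] by simp

lemma act_inv_mult:
  assumes g: "g \<in> carrier G" and h: "h \<in> carrier G" and "dist (act g x) (act h x) \<le> c"
  shows "dist (act (inv g \<otimes> h) x) x \<le> K * c + 4 * A"
proof -
  have "dist (act (inv g) (act h x)) (act (inv g) (act g x)) \<le> K * c + A"
    using act_lipschitz_le[of "inv g"] assms by (simp add: dist_commute)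
  moreover have "dist (act (inv g \<otimes> h) x) (act (inv g) (act h x)) \<le> A"
    using act_mult[OF h, of "inv g"] g by (simp add: dist_commute)
  ultimately show ?thesis
    using act_inv_left[OF g, of x] dist_triangle[of "act (inv g \<otimes> h) x" x "act (inv g) (act h x)"]
      dist_triangle[of "act (inv g) (act h x)" x "act (inv g) (act g x)"] by linarith
qed

definition almost_fix :: "real \<Rightarrow> 'a set" where
  "almost_fix r = {g \<in> carrier G. \<forall>z\<in>cball x0 r. dist (act g z) z \<le> B}"

text \<open>Almost fixing a ball with constant \<open>B\<close> need not pass to the inverse with
  the same constant, hence both conditions. The radii are multiples of \<open>R\<close> because each
  use of tameness loses \<open>R\<close>, that is, one index. At \<open>n = 0\<close> only the
  displacement of \<open>x0\<close> is constrained.\<close>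

definition U :: "nat \<Rightarrow> 'a set" where
  "U n = {g \<in> carrier G. g \<in> almost_fix (real n * R) \<and> inv g \<in> almost_fix (real n * R)}"

text \<open>The self-improvement step: a weak bound on a ball larger by \<open>R\<close> yields the
  bound \<open>B\<close>. The closure properties below only have to reach the weak bound.\<close>

lemma almost_fixI:
  assumes g: "g \<in> carrier G"
    and "\<And>z. z \<in> cball x0 (r + R) \<Longrightarrow> dist (act g z) z \<le> K * (2 * K + 3 * A + 2 + B) + 5 * A + B"
  shows "g \<in> almost_fix r"
proof -
  have "dist (act g y) y \<le> B" if y: "y \<in> cball x0 r" for y
  proof (rule tame[OF g])
    fix z assume "z \<in> cball y R"
    then have "z \<in> cball x0 (r + R)" using y dist_triangle[of x0 z y] by simp
    then show "dist (act g z) z \<le> K * (2 * K + 3 * A + 2 + B) + 5 * A + B" using assms(2) by blast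
  qed
  then show ?thesis using g by (simp add: almost_fix_def)
qed

lemma almost_fix_antimono: "r \<le> s \<Longrightarrow> almost_fix s \<subseteq> almost_fix r"
  by (auto simp: almost_fix_def)

lemma almost_fix_mult:
  assumes g: "g \<in> almost_fix (r + R)" and h: "h \<in> almost_fix (r + R)"
  shows "g \<otimes> h \<in> almost_fix r"
proof (rule almost_fixI)
  have gh: "g \<in> carrier G" "h \<in> carrier G" using g h by (auto simp: almost_fix_def)
  then show "g \<otimes> h \<in> carrier G" by simp
  fix z assume z: "z \<in> cball x0 (r + R)"
  have "dist (act (g \<otimes> h) z) (act g (act h z)) \<le> A" using act_mult gh by (simp add: dist_commute)
  moreover have "dist (act g (act h z)) (act g z) \<le> K * B + A"
    using act_lipschitz_le gh(1) h z by (simp add: almost_fix_def)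
  moreover have "dist (act g z) z \<le> B" using g z by (simp add: almost_fix_def)
  ultimately have "dist (act (g \<otimes> h) z) z \<le> K * B + 2 * A + B"
    using dist_triangle[of "act (g \<otimes> h) z" z "act g (act h z)"] dist_triangle[of "act g (act h z)" z "act g z"]
    by linarith
  also have "\<dots> \<le> K * (2 * K + 3 * A + 2 + B) + 5 * A + B"
    proof -
      have "K * B \<le> K * (2 * K + 3 * A + 2 + B)" using K A B by (intro mult_left_mono) auto
      then show ?thesis using A B by linarith
    qed
  finally show "dist (act (g \<otimes> h) z) z \<le> \<dots>" .
qed

text \<open>\<open>inv h\<close> carries the ball of radius \<open>r + R\<close> into the ball of
  radius \<open>s\<close>, where \<open>u\<close> moves points by at most \<open>B\<close>. The
  radius \<open>s\<close> depends on \<open>h\<close> only through \<open>M\<close>, so the estimate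
  is uniform over all \<open>h\<close> of bounded displacement.\<close>

lemma almost_fix_conj:
  assumes h: "h \<in> carrier G" "dist (act h x0) x0 \<le> M" and u: "u \<in> almost_fix s"
    and s: "K * (r + R) + K * M + 4 * A \<le> s"
  shows "h \<otimes> u \<otimes> inv h \<in> almost_fix r"
proof (rule almost_fixI)
  have uc: "u \<in> carrier G" using u by (simp add: almost_fix_def)
  then show "h \<otimes> u \<otimes> inv h \<in> carrier G" using h by simp
  fix z assume z: "z \<in> cball x0 (r + R)"
  define w where "w = act (inv h) z"
  have "dist (act (inv h) (act h x0)) w \<le> K * (M + (r + R)) + A"
    unfolding w_def
    using act_lipschitz_le[of "inv h" "act h x0" z "M + (r + R)"] h z dist_triangle[of "act h x0" z x0] by simp
  then have "dist x0 w \<le> s"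
    using act_inv_left[OF h(1), of x0] dist_triangle[of x0 w "act (inv h) (act h x0)"] s A
    by (simp add: dist_commute algebra_simps)
  then have uw: "dist (act u w) w \<le> B" using u by (simp add: almost_fix_def)
  have "dist (act (u \<otimes> inv h) z) (act u w) \<le> A"
    unfolding w_def using act_mult[of "inv h" u z] h uc by (simp add: dist_commute)
  then have "dist (act (u \<otimes> inv h) z) w \<le> A + B"
    using uw dist_triangle[of "act (u \<otimes> inv h) z" w "act u w"] by linarith
  then have "dist (act h (act (u \<otimes> inv h) z)) (act h w) \<le> K * (A + B) + A"
    using act_lipschitz_le h by blast
  moreover have "dist (act (h \<otimes> u \<otimes> inv h) z) (act h (act (u \<otimes> inv h) z)) \<le> A"
    using act_mult[of "u \<otimes> inv h" h z] h uc by (simp add: m_assoc dist_commute)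
  moreover have "dist (act h w) z \<le> 2 * A" unfolding w_def using act_inv_right h by simp
  ultimately have "dist (act (h \<otimes> u \<otimes> inv h) z) z \<le> K * (A + B) + 4 * A"
    using dist_triangle[of "act (h \<otimes> u \<otimes> inv h) z" z "act h (act (u \<otimes> inv h) z)"]
      dist_triangle[of "act h (act (u \<otimes> inv h) z)" z "act h w"] by linarith
  also have "\<dots> \<le> K * (2 * K + 3 * A + 2 + B) + 5 * A + B"
    proof -
      have "K * (A + B) \<le> K * (2 * K + 3 * A + 2 + B)" using K A B by (intro mult_left_mono) auto
      then show ?thesis using A B by linarith
    qed
  finally show "dist (act (h \<otimes> u \<otimes> inv h) z) z \<le> \<dots>" .
qed

lemma U_displacement: "u \<in> U n \<Longrightarrow> dist (act u x0) x0 \<le> B"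
  using R by (auto simp: U_def almost_fix_def)

lemma U_group_nbhd: "group_nbhd G U"
proof (intro group_nbhd.intro group_nbhd_axioms.intro is_group)
  fix n
  show "U n \<subseteq> carrier G" by (auto simp: U_def)
  have "dist (act \<one> z) z \<le> B" for z using act_one AB order_trans by blast
  then show "\<one> \<in> U n" by (simp add: U_def almost_fix_def)
  show "U (Suc n) \<subseteq> U n"
    using almost_fix_antimono[of "real n * R" "real (Suc n) * R"] R by (auto simp: U_def)
next
  fix g n assume "g \<in> U n"
  then show "inv g \<in> U n" by (auto simp: U_def)
next
  fix g h n assume gh: "g \<in> U (Suc n)" "h \<in> U (Suc n)"
  have "real (Suc n) * R = real n * R + R" by (simp add: algebra_simps)
  then show "g \<otimes> h \<in> U n" using gh by (auto simp: U_def inv_mult_group intro!: almost_fix_mult)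
next
  fix g n assume g: "g \<in> carrier G"
  obtain m where m: "K * (real n * R + R) + K * dist (act g x0) x0 + 4 * A \<le> real m * R"
    using reals_Archimedean3[OF R] less_imp_le by blast
  have "g \<otimes> u \<otimes> inv g \<in> U n" if u: "u \<in> U m" for u
  proof -
    have "g \<otimes> u \<otimes> inv g \<in> almost_fix (real n * R)" "g \<otimes> inv u \<otimes> inv g \<in> almost_fix (real n * R)"
      using u almost_fix_conj[OF g order.refl _ m] by (auto simp: U_def)
    moreover have "inv (g \<otimes> u \<otimes> inv g) = g \<otimes> inv u \<otimes> inv g"
      using g u by (simp add: U_def inv_mult_group m_assoc)
    ultimately show ?thesis using g u by (simp add: U_def)
  qed
  then show "\<exists>m. \<forall>u\<in>U m. g \<otimes> u \<otimes> inv g \<in> U n" by blast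
qed

sublocale nbhd: group_nbhd G U
  by (rule U_group_nbhd)

text \<open>Displacement is uniformly bounded on a coset of \<open>U 0\<close>. This turns
  \<open>almost_fix_conj\<close> into \<open>U_conj_near\<close>, and finite covers by cosets into
  bounded sets.\<close>

lemma near_displacement:
  assumes g: "g \<in> carrier G" and h: "h \<in> carrier G" and "nbhd.near n g h"
  shows "dist (act h x0) x0 \<le> K * B + 2 * A + dist (act g x0) x0"
proof -
  have "dist (act (inv g \<otimes> h) x0) x0 \<le> B" using assms(3) U_displacement by (simp add: nbhd.near_def)
  then have "dist (act g (act (inv g \<otimes> h) x0)) (act g x0) \<le> K * B + A" using act_lipschitz_le g by blast
  moreover have "g \<otimes> (inv g \<otimes> h) = h" using g h by (simp add: m_assoc[symmetric])
  then have "dist (act h x0) (act g (act (inv g \<otimes> h) x0)) \<le> A"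
    using act_mult[of "inv g \<otimes> h" g x0] g h by (simp add: dist_commute)
  ultimately show ?thesis
    using dist_triangle[of "act h x0" x0 "act g (act (inv g \<otimes> h) x0)"]
      dist_triangle[of "act g (act (inv g \<otimes> h) x0)" x0 "act g x0"] by linarith
qed

section \<open>Bounded sets are the precompact ones\<close>

lemma qa_bounded_displacement:
  assumes T: "T \<subseteq> carrier G" and "qa_bounded act T"
  obtains M where "\<And>t. t \<in> T \<Longrightarrow> dist (act t x) x \<le> M"
proof -
  obtain y where "bounded ((\<lambda>t. act t y) ` T)" using assms(2) by (auto simp: qa_bounded_def)
  then obtain M where M: "\<And>t. t \<in> T \<Longrightarrow> dist x (act t y) \<le> M"
    by (auto simp: bounded_any_center[of _ x])
  have "dist (act t x) x \<le> K * dist x y + A + M" if t: "t \<in> T" for t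
    using act_lipschitz[of t x y] M[OF t] t T dist_triangle[of "act t x" x "act t y"]
    by (auto simp: dist_commute)
  then show ?thesis using that by blast
qed

lemma compact_finite_net:
  assumes "compact (S :: 'b set)"
  obtains N where "finite N" "N \<subseteq> S" "\<And>x. x \<in> S \<Longrightarrow> \<exists>p\<in>N. dist x p \<le> 1"
proof -
  obtain N where N: "finite N" "N \<subseteq> S" "S \<subseteq> (\<Union>p\<in>N. ball p 1)"
    using seq_compact_imp_totally_bounded[OF compact_imp_seq_compact[OF assms]] zero_less_one by meson
  have "\<exists>p\<in>N. dist x p \<le> 1" if x: "x \<in> S" for x
  proof -
    obtain p where "p \<in> N" "x \<in> ball p 1" using N(3) x by blast
    then show ?thesis by (intro bexI[of _ p]) (auto simp: dist_commute)
  qed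
  then show ?thesis using N that by blast
qed

text \<open>Elements of a bounded set are sorted by where, up to distance 1, they send a finite net of a ball;
  there are finitely many patterns, and two elements with the same pattern are near.\<close>
lemma qa_bounded_cover:
  assumes T: "T \<subseteq> carrier G" and bdd: "qa_bounded act T"
  shows "\<exists>F. finite F \<and> F \<subseteq> carrier G \<and> (\<forall>t\<in>T. \<exists>f\<in>F. nbhd.near n f t)"
proof -
  \<comment> \<open>The extra \<open>R\<close> is the radius spent by
    \<open>almost_fixI\<close>.\<close>
  define r where "r = real n * R + R"
  obtain M where M: "\<And>t. t \<in> T \<Longrightarrow> dist (act t x0) x0 \<le> M"
    using qa_bounded_displacement[OF T bdd] by blast
  obtain N where N: "finite N" "N \<subseteq> cball x0 r" "\<And>x. x \<in> cball x0 r \<Longrightarrow> \<exists>p\<in>N. dist x p \<le> 1"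
    using compact_finite_net[OF proper] by blast
  obtain Q where Q: "finite Q" "\<And>x. x \<in> cball x0 (K * r + A + M) \<Longrightarrow> \<exists>q\<in>Q. dist x q \<le> 1"
    using compact_finite_net[OF proper] by metis
  have "\<exists>q\<in>Q. dist (act t p) q \<le> 1" if t: "t \<in> T" and p: "p \<in> N" for t p
  proof (rule Q(2))
    have "t \<in> carrier G" "dist x0 p \<le> r" using t T p N(2) by auto
    then have "dist (act t x0) (act t p) \<le> K * r + A" by (rule act_lipschitz_le)
    then show "act t p \<in> cball x0 (K * r + A + M)"
      using M[OF t] dist_triangle[of x0 "act t p" "act t x0"] by (simp add: dist_commute)
  qed
  then have "\<forall>t\<in>T. \<forall>p\<in>N. \<exists>q. q \<in> Q \<and> dist (act t p) q \<le> 1" by blast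
  then obtain c where c: "\<And>t p. t \<in> T \<Longrightarrow> p \<in> N \<Longrightarrow> c t p \<in> Q \<and> dist (act t p) (c t p) \<le> 1" by metis
  define pat where "pat t = restrict (c t) N" for t
  have "pat ` T \<subseteq> N \<rightarrow>\<^sub>E Q" using c by (auto simp: pat_def)
  then have "finite (pat ` T)" using finite_PiE[OF N(1), of "\<lambda>_. Q"] Q(1) finite_subset by blast
  then obtain F where F: "F \<subseteq> T" "finite F" "pat ` T = pat ` F"
    using finite_subset_image[of "pat ` T" pat T] by blast
  have fix_: "inv s \<otimes> t \<in> almost_fix (real n * R)" if st: "s \<in> T" "t \<in> T" "pat s = pat t" for s t
  proof (rule almost_fixI)
    have stc: "s \<in> carrier G" "t \<in> carrier G" using st T by auto
    then show "inv s \<otimes> t \<in> carrier G" by simp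
    fix z assume "z \<in> cball x0 (real n * R + R)"
    then obtain p where p: "p \<in> N" "dist z p \<le> 1" using N(3) unfolding r_def by blast
    have "c s p = c t p" using st(3) p(1) unfolding pat_def by (metis restrict_apply')
    then have "dist (act s p) (act t p) \<le> 2"
      using c[OF st(1) p(1)] c[OF st(2) p(1)] dist_triangle[of "act s p" "act t p" "c s p"] by (simp add: dist_commute)
    moreover have "dist (act s z) (act s p) \<le> K + A" "dist (act t p) (act t z) \<le> K + A"
      using act_lipschitz_le[OF stc(1) p(2)] act_lipschitz_le[OF stc(2) p(2)] by (simp_all add: dist_commute)
    ultimately have "dist (act s z) (act t z) \<le> 2 * K + 2 * A + 2"
      using dist_triangle[of "act s z" "act t z" "act s p"] dist_triangle[of "act s p" "act t z" "act t p"] by linarith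
    then have "dist (act (inv s \<otimes> t) z) z \<le> K * (2 * K + 2 * A + 2) + 4 * A" by (rule act_inv_mult[OF stc])
    also have "\<dots> \<le> K * (2 * K + 3 * A + 2 + B) + 5 * A + B"
      proof -
        have "K * (2 * K + 2 * A + 2) \<le> K * (2 * K + 3 * A + 2 + B)" using K A B by (intro mult_left_mono) auto
        then show ?thesis using A B by linarith
      qed
    finally show "dist (act (inv s \<otimes> t) z) z \<le> \<dots>" .
  qed
  have "\<exists>f\<in>F. nbhd.near n f t" if t: "t \<in> T" for t
  proof -
    obtain f where f: "f \<in> F" "pat t = pat f" using F(3) t by blast
    have fc: "f \<in> carrier G" "t \<in> carrier G" "f \<in> T" using f(1) F(1) t T by auto
    then have "inv f \<otimes> t \<in> U n"
      using fix_[of f t] fix_[of t f] t f(2) by (simp add: U_def inv_mult_group)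
    then show ?thesis using f(1) by (auto simp: nbhd.near_def)
  qed
  then show ?thesis using F T by blast
qed

lemma U_precompact: "precompact_group_nbhd G U"
proof (intro precompact_group_nbhd.intro U_group_nbhd precompact_group_nbhd_axioms.intro)
  fix g n assume g: "g \<in> carrier G"
  define M where "M = K * B + 2 * A + dist (act g x0) x0"
  obtain m where m: "K * (real n * R + R) + K * M + 4 * A \<le> real m * R"
    using reals_Archimedean3[OF R] less_imp_le by blast
  have "h \<otimes> u \<otimes> inv h \<in> U n" if h: "h \<in> carrier G" "nbhd.near 0 g h" and u: "u \<in> U m" for h u
  proof -
    have hM: "dist (act h x0) x0 \<le> M" unfolding M_def by (rule near_displacement[OF g h])
    have "h \<otimes> u \<otimes> inv h \<in> almost_fix (real n * R)" "h \<otimes> inv u \<otimes> inv h \<in> almost_fix (real n * R)"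
      using u almost_fix_conj[OF h(1) hM _ m] by (auto simp: U_def)
    moreover have "inv (h \<otimes> u \<otimes> inv h) = h \<otimes> inv u \<otimes> inv h"
      using h u by (simp add: U_def inv_mult_group m_assoc)
    ultimately show ?thesis using h u by (simp add: U_def)
  qed
  then show "\<exists>m. \<forall>h\<in>carrier G. nbhd.near 0 g h \<longrightarrow> (\<forall>u\<in>U m. h \<otimes> u \<otimes> inv h \<in> U n)" by blast
next
  have "bounded ((\<lambda>t. act t x0) ` U 0)"
    unfolding bounded_any_center[of _ x0] using U_displacement by (auto simp: dist_commute)
  then have "qa_bounded act (U 0)" by (auto simp: qa_bounded_def)
  then show "nbhd.tot_bounded (U 0)"
    unfolding nbhd.tot_bounded_def using qa_bounded_cover[OF nbhd.U_carrier] by blast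
qed

lemma qa_bounded_iff:
  assumes T: "T \<subseteq> carrier G"
  shows "qa_bounded act T \<longleftrightarrow> (\<exists>F. finite F \<and> F \<subseteq> carrier G \<and> (\<forall>t\<in>T. \<exists>f\<in>F. nbhd.near 0 f t))"
proof
  assume "qa_bounded act T"
  then show "\<exists>F. finite F \<and> F \<subseteq> carrier G \<and> (\<forall>t\<in>T. \<exists>f\<in>F. nbhd.near 0 f t)"
    by (rule qa_bounded_cover[OF T])
next
  assume "\<exists>F. finite F \<and> F \<subseteq> carrier G \<and> (\<forall>t\<in>T. \<exists>f\<in>F. nbhd.near 0 f t)"
  then obtain F where F: "finite F" "F \<subseteq> carrier G" "\<forall>t\<in>T. \<exists>f\<in>F. nbhd.near 0 f t" by blast
  define M where "M = (\<Sum>f\<in>F. dist (act f x0) x0)"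
  have "dist x0 (act t x0) \<le> K * B + 2 * A + M" if t: "t \<in> T" for t
  proof -
    obtain f where f: "f \<in> F" "nbhd.near 0 f t" using F(3) t by blast
    have "dist (act f x0) x0 \<le> M" unfolding M_def using F(1) f(1) by (intro member_le_sum) auto
    moreover have "dist (act t x0) x0 \<le> K * B + 2 * A + dist (act f x0) x0"
      using near_displacement[OF _ _ f(2)] f(1) F(2) t T by blast
    ultimately show ?thesis by (simp add: dist_commute)
  qed
  then have "bounded ((\<lambda>t. act t x0) ` T)" unfolding bounded_any_center[of _ x0] by blast
  then show "qa_bounded act T" by (auto simp: qa_bounded_def)
qed

lemma has_topological_completion:
  "\<exists>(H :: 'a set set monoid) \<tau> \<rho>. topological_completion G act H \<tau> \<rho>"
proof -
  interpret precompact_group_nbhd G U by (rule U_precompact)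
  have "topological_completion G act completion hat.gtop embed"
    unfolding topological_completion_def
    using hat.topological_group_gtop hat_Hausdorff hat.locally_compact_gtop[OF hat_complete hat_tot_bounded]
      embed_hom hat_dense hat_bounded_iff_compact qa_bounded_iff by simp
  then show ?thesis by blast
qed

end

theorem theoremD:
  fixes G :: "'g monoid" and act :: "'g \<Rightarrow> 'a::metric_space \<Rightarrow> 'a" and K A :: real
  assumes "proper_space TYPE('a)" and "geodesic_space TYPE('a)" and "cocompact TYPE('a)"
    and "\<exists>p\<in>morse_boundary TYPE('a). \<exists>q\<in>morse_boundary TYPE('a). \<exists>r\<in>morse_boundary TYPE('a).
           p \<noteq> q \<and> p \<noteq> r \<and> q \<noteq> r"
    and "group G" and "quasi_action G act K A" and "cobounded_qa G act"
  shows "\<exists>(H :: 'g set set monoid) \<tau> \<rho>. topological_completion G act H \<tau> \<rho>"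
proof -
  have KA: "1 \<le> K" "0 \<le> A" using assms(6) by (auto simp: quasi_action_def)
  obtain B0 where B0: "\<And>S. \<exists>R. \<forall>f (y::'a). qi_embedding K A f \<longrightarrow>
      (\<forall>z\<in>cball y R. dist (f z) z \<le> S) \<longrightarrow> dist (f y) y \<le> B0"
    using locally_tame[OF assms(2-4) KA] by blast
  define B where "B = max A B0"
  obtain R0 where R0: "\<And>f (y::'a). qi_embedding K A f \<Longrightarrow>
      (\<forall>z\<in>cball y R0. dist (f z) z \<le> K * (2 * K + 3 * A + 2 + B) + 5 * A + B) \<Longrightarrow> dist (f y) y \<le> B0"
    using B0 by blast
  define R where "R = max 1 R0"
  have "tame_quasi_action G act K A B R"
  proof (intro tame_quasi_action.intro tame_quasi_action_axioms.intro assms(5,6))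
    show "A \<le> B" "0 < R" by (auto simp: B_def R_def)
    show "compact (cball (x :: 'a) r)" for x r using assms(1) by (simp add: proper_space_def)
    fix g and y :: 'a
    assume g: "g \<in> carrier G"
      and S: "\<And>z. z \<in> cball y R \<Longrightarrow> dist (act g z) z \<le> K * (2 * K + 3 * A + 2 + B) + 5 * A + B"
    have "qi_embedding K A (act g)"
      using assms(6) g by (simp add: quasi_action_def quasi_isometry_def qi_embedding_def)
    then have "dist (act g y) y \<le> B0" using R0 S by (simp add: R_def)
    then show "dist (act g y) y \<le> B" by (simp add: B_def)
  qed
  then show ?thesis by (rule tame_quasi_action.has_topological_completion)
qed

end
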